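(* Let $\Pi,\Pi'$ be pure formulas and $\Sigma,\Sigma'$ spatial conjunctions. Then the procedure $\mathrm{Prove}(\Pi\land\Sigma\rightarrow\Pi'\land\Sigma')$ always terminates, and it returns $\mathrm{valid}$ if and only if the entailment $\Pi\land\Sigma\rightarrow\Pi'\land\Sigma'$ is valid (and returns $\mathrm{invalid}$ otherwise).
   Context: Setting: a many-sorted first-order language with sorts including $\mathsf{Int}$ and $\mathsf{Bool}$, equality $\simeq$, classical boolean connectives and quantifiers, and further theory symbols (supported by an SMT solver) with standard interpretations; satisfiability of pure formulas is decided by an oracle which, for a satisfiable pure formula, returns a satisfying stack. Pure = containing no spatial symbol. A stack $s$ maps variables to values of their sorts and is extended to pure expressions. A heap is a partial function $h\colon\mathbb{Z}\rightharpoonup\mathsf{Val}$; $h=h_1\ast\dots\ast h_n$ means $h$ is the union of the $h_i$ with pairwise disjoint domains. Spatial predicates: $\mathrm{emp}$, $\mathrm{next}(x,y)$, $\mathrm{lseg}(x,y)$ with $x,y$ pure $\mathsf{Int}$ expressions. A spatial conjunction $\Sigma=S_1\ast\dots\ast S_n$ ($n\ge0$) is a finite multiset of spatial predicates; $S\in\Sigma$, $\Sigma\setminus S$ (remove one occurrence) and $\ast$ are multiset operations; the empty conjunction denotes $\mathrm{emp}$. Semantics: $s,h\models\Pi$ (pure) iff $s(\Pi)=\top$; $s,h\models\mathrm{emp}$ iff $h=\emptyset$; $s,h\models\mathrm{next}(x,y)$ iff $h=\{s(x)\mapsto s(y)\}$; $s,h\models F_1\ast F_2$ iff $h=h_1\ast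 h_2$ with $s,h_i\models F_i$; $s,h\models\mathrm{lseg}(x,z)$ iff there are $n\ge0$ and integers $a_0,\dots,a_n$ with $a_0=s(x)$, $a_n=s(z)$, $a_i\ne s(z)$ for $i<n$ and $h=\{a_0\mapsto a_1\}\ast\dots\ast\{a_{n-1}\mapsto a_n\}$; $\land,\lor,\lnot,\rightarrow$ classical. A formula is valid if it is satisfied by every pair $(s,h)$; $s\models F$ means $s,h\models F$ for all heaps $h$. Auxiliary definitions: $\mathrm{Empty}(\mathrm{emp})=\top$, $\mathrm{Empty}(\mathrm{next}(x,y))=\bot$, $\mathrm{Empty}(\mathrm{lseg}(x,y))=(x\simeq y)$; $\mathrm{Addr}(\mathrm{next}(x,y))=\mathrm{Addr}(\mathrm{lseg}(x,y))=x$. $\mathrm{Collide}(S,S')=\lnot\mathrm{Empty}(S)\land\lnot\mathrm{Empty}(S')\land\mathrm{Addr}(S)\simeq\mathrm{Addr}(S')$ ($\bot$ if either is $\mathrm{emp}$). $\mathrm{WellFormed}(S_1\ast\dots\ast S_n)=\bigwedge_{1\le i<j\le n}\lnot\mathrm{Collide}(S_i,S_j)$. $\mathrm{Alloc}(S_1\ast\dots\ast S_n,x)=\bigvee_{i}(\lnot\mathrm{Empty}(S_i)\land x\simeq\mathrm{Addr}(S_i))$. For $S\in\{\mathrm{next}(x,y),\mathrm{lseg}(x,y)\}$, $S'\in\{\mathrm{next}(x',z),\mathrm{lseg}(x',z)\}$, $\mathrm{Update}(S,S')$ and $\mathrm{Check}(\hat\Sigma,S,S')$ are: $(\mathrm{next},\mathrm{next})$: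 $\mathrm{emp}$, $y\simeq z$; $(\mathrm{next},\mathrm{lseg})$: $\mathrm{lseg}(y,z)$, $\top$; $(\mathrm{lseg},\mathrm{next})$: $\mathrm{emp}$, $\bot$; $(\mathrm{lseg},\mathrm{lseg})$: $\mathrm{lseg}(y,z)$, $y\not\simeq z\rightarrow\mathrm{Alloc}(\hat\Sigma,z)$. $\mathrm{Guard}(\hat\Sigma,S,S')=\mathrm{Collide}(S,S')\land\mathrm{Check}(\hat\Sigma,S,S')$ ($\bot$ if $S$ or $S'$ is $\mathrm{emp}$). $\mathrm{Match}(s,\hat\Sigma,\Sigma,\Sigma')$ returns a pure formula (each "there is" picks an arbitrary witness): 1. if there is $S\in\Sigma$ with $s\models\mathrm{Empty}(S)$, return $\mathrm{Empty}(S)\land\mathrm{Match}(s,\hat\Sigma,\Sigma\setminus S,\Sigma')$; 2. else if there is $S'\in\Sigma'$ with $s\models\mathrm{Empty}(S')$, return $\mathrm{Empty}(S')\land\mathrm{Match}(s,\hat\Sigma,\Sigma,\Sigma'\setminus S')$; 3. else if there are $S\in\Sigma$, $S'\in\Sigma'$ with $s\models\mathrm{Guard}(\hat\Sigma,S,S')$, return $\mathrm{Guard}(\hat\Sigma,S,S')\land\mathrm{Match}(s,\hat\Sigma,\Sigma\setminus S,(\Sigma'\setminus S')\ast\mathrm{Update}(S,S'))$; 4. else return $\top$ if $\Sigma$ and $\Sigma'$ are both empty and $\bot$ otherwise. $\mathrm{Prove}(\Pi\land\Sigma\rightarrow\Pi'\land\Sigma')$: set $\Gamma:=\Pi\land\mathrm{WellFormed}(\Sigma)$;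 while there exists a stack $s$ with $s\models\Gamma$ (obtained from the oracle): let $U:=\mathrm{Match}(s,\Sigma,\Sigma,\Sigma')$; if $s\not\models\Pi'\land U$, return $\mathrm{invalid}$; otherwise set $\Gamma:=\Gamma\land\lnot(\Pi'\land U)$. When no such $s$ exists, return $\mathrm{valid}$. *)

theory Defs
  imports "HOL-Library.Multiset"
begin

section \<open>Many-sorted pure expressions\<close>

datatype 's sort = IntS | BoolS | OtherS 's

datatype 'u val = VInt int | VBool bool | VOther 'u

text \<open>A signature together with its intended interpretation. The interpretation of the
  sorts \<open>IntS\<close> and \<open>BoolS\<close> is fixed; that of all further sorts and of all
  theory symbols is a parameter.\<close>

record ('f, 's, 'u) struct =
  rank :: "'f \<Rightarrow> 's sort list \<times> 's sort"
  universe :: "'s \<Rightarrow> 'u set"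
  interp :: "'f \<Rightarrow> 'u val list \<Rightarrow> 'u val"

fun carrier :: "('f, 's, 'u) struct \<Rightarrow> 's sort \<Rightarrow> 'u val set" where
  "carrier T IntS = range VInt"
| "carrier T BoolS = range VBool"
| "carrier T (OtherS \<sigma>) = VOther ` universe T \<sigma>"

definition wf_struct :: "('f, 's, 'u) struct \<Rightarrow> bool" where
  "wf_struct T \<longleftrightarrow>
     (\<forall>\<sigma>. universe T \<sigma> \<noteq> {}) \<and>
     (\<forall>f vs. list_all2 (\<lambda>v \<sigma>. v \<in> carrier T \<sigma>) vs (fst (rank T f))
        \<longrightarrow> interp T f vs \<in> carrier T (snd (rank T f)))"

text \<open>Formulas are the expressions of sort \<open>BoolS\<close>. A variable carries its sort.\<close>

type_synonym ('x, 's) var = "'x \<times> 's sort"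

datatype ('f, 's, 'x) expr =
    Var "('x, 's) var"
  | App 'f "('f, 's, 'x) expr list"
  | Eq "('f, 's, 'x) expr" "('f, 's, 'x) expr"
  | Top
  | Bot
  | Neg "('f, 's, 'x) expr"
  | Conj "('f, 's, 'x) expr" "('f, 's, 'x) expr"
  | Disj "('f, 's, 'x) expr" "('f, 's, 'x) expr"
  | Impl "('f, 's, 'x) expr" "('f, 's, 'x) expr"
  | Forall "('x, 's) var" "('f, 's, 'x) expr"
  | Exists "('x, 's) var" "('f, 's, 'x) expr"

inductive has_sort :: "('f, 's, 'u) struct \<Rightarrow> ('f, 's, 'x) expr \<Rightarrow> 's sort \<Rightarrow> bool"
  for T :: "('f, 's, 'u) struct" where
  "has_sort T (Var (x, \<sigma>)) \<sigma>"
| "list_all2 (has_sort T) es (fst (rank T f)) \<Longrightarrow> has_sort T (App f es) (snd (rank T f))"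
| "has_sort T a \<sigma> \<Longrightarrow> has_sort T b \<sigma> \<Longrightarrow> has_sort T (Eq a b) BoolS"
| "has_sort T Top BoolS"
| "has_sort T Bot BoolS"
| "has_sort T a BoolS \<Longrightarrow> has_sort T (Neg a) BoolS"
| "has_sort T a BoolS \<Longrightarrow> has_sort T b BoolS \<Longrightarrow> has_sort T (Conj a b) BoolS"
| "has_sort T a BoolS \<Longrightarrow> has_sort T b BoolS \<Longrightarrow> has_sort T (Disj a b) BoolS"
| "has_sort T a BoolS \<Longrightarrow> has_sort T b BoolS \<Longrightarrow> has_sort T (Impl a b) BoolS"
| "has_sort T a BoolS \<Longrightarrow> has_sort T (Forall v a) BoolS"
| "has_sort T a BoolS \<Longrightarrow> has_sort T (Exists v a) BoolS"

type_synonym ('s, 'x, 'u) stack = "('x, 's) var \<Rightarrow> 'u val"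

definition is_stack :: "('f, 's, 'u) struct \<Rightarrow> ('s, 'x, 'u) stack \<Rightarrow> bool" where
  "is_stack T s \<longleftrightarrow> (\<forall>v. s v \<in> carrier T (snd v))"

fun eval :: "('f, 's, 'u) struct \<Rightarrow> ('s, 'x, 'u) stack \<Rightarrow> ('f, 's, 'x) expr \<Rightarrow> 'u val" where
  "eval T s (Var v) = s v"
| "eval T s (App f es) = interp T f (map (eval T s) es)"
| "eval T s (Eq a b) = VBool (eval T s a = eval T s b)"
| "eval T s Top = VBool True"
| "eval T s Bot = VBool False"
| "eval T s (Neg a) = VBool (\<not> eval T s a = VBool True)"
| "eval T s (Conj a b) = VBool (eval T s a = VBool True \<and> eval T s b = VBool True)"
| "eval T s (Disj a b) = VBool (eval T s a = VBool True \<or> eval T s b = VBool True)"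
| "eval T s (Impl a b) = VBool (eval T s a = VBool True \<longrightarrow> eval T s b = VBool True)"
| "eval T s (Forall v a) =
     VBool (\<forall>u \<in> carrier T (snd v). eval T (s(v := u)) a = VBool True)"
| "eval T s (Exists v a) =
     VBool (\<exists>u \<in> carrier T (snd v). eval T (s(v := u)) a = VBool True)"

definition holds :: "('f, 's, 'u) struct \<Rightarrow> ('s, 'x, 'u) stack \<Rightarrow> ('f, 's, 'x) expr \<Rightarrow> bool" where
  "holds T s P \<longleftrightarrow> eval T s P = VBool True"

text \<open>The answers an oracle for satisfiability of pure formulas may give. Different calls on the
  same formula may be answered by different stacks.\<close>

fun oracle_answer ::
  "('f, 's, 'u) struct \<Rightarrow> ('f, 's, 'x) expr \<Rightarrow> ('s, 'x, 'u) stack option \<Rightarrow> bool" where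
  "oracle_answer T P (Some s) \<longleftrightarrow> is_stack T s \<and> holds T s P"
| "oracle_answer T P None \<longleftrightarrow> (\<nexists>s. is_stack T s \<and> holds T s P)"


section \<open>Spatial formulas\<close>

datatype ('f, 's, 'x) spred =
    Emp
  | Next "('f, 's, 'x) expr" "('f, 's, 'x) expr"
  | Lseg "('f, 's, 'x) expr" "('f, 's, 'x) expr"

fun wf_spred :: "('f, 's, 'u) struct \<Rightarrow> ('f, 's, 'x) spred \<Rightarrow> bool" where
  "wf_spred T Emp \<longleftrightarrow> True"
| "wf_spred T (Next x y) \<longleftrightarrow> has_sort T x IntS \<and> has_sort T y IntS"
| "wf_spred T (Lseg x y) \<longleftrightarrow> has_sort T x IntS \<and> has_sort T y IntS"

type_synonym ('f, 's, 'x) sconj = "('f, 's, 'x) spred multiset"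

datatype ('f, 's, 'x) formula =
    FPure "('f, 's, 'x) expr"
  | FSpred "('f, 's, 'x) spred"
  | FStar "('f, 's, 'x) formula" "('f, 's, 'x) formula"
  | FNeg "('f, 's, 'x) formula"
  | FConj "('f, 's, 'x) formula" "('f, 's, 'x) formula"
  | FDisj "('f, 's, 'x) formula" "('f, 's, 'x) formula"
  | FImpl "('f, 's, 'x) formula" "('f, 's, 'x) formula"

type_synonym 'u heap = "int \<rightharpoonup> 'u val"

definition heap_sum :: "'u heap \<Rightarrow> 'u heap list \<Rightarrow> bool" where
  "heap_sum h hs \<longleftrightarrow>
     (\<forall>i j. i < j \<and> j < length hs \<longrightarrow> dom (hs ! i) \<inter> dom (hs ! j) = {}) \<and>
     h = foldr (++) hs Map.empty"

fun sat_spred ::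
  "('f, 's, 'u) struct \<Rightarrow> ('s, 'x, 'u) stack \<Rightarrow> 'u heap \<Rightarrow> ('f, 's, 'x) spred \<Rightarrow> bool" where
  "sat_spred T s h Emp \<longleftrightarrow> h = Map.empty"
| "sat_spred T s h (Next x y) \<longleftrightarrow> (\<exists>a. eval T s x = VInt a \<and> h = [a \<mapsto> eval T s y])"
| "sat_spred T s h (Lseg x z) \<longleftrightarrow>
     (\<exists>(n::nat) (a :: nat \<Rightarrow> int).
        VInt (a 0) = eval T s x \<and> VInt (a n) = eval T s z \<and>
        (\<forall>i<n. VInt (a i) \<noteq> eval T s z) \<and>
        heap_sum h (map (\<lambda>i. [a i \<mapsto> VInt (a (Suc i))]) [0..<n]))"

fun sat :: "('f, 's, 'u) struct \<Rightarrow> ('s, 'x, 'u) stack \<Rightarrow> 'u heap \<Rightarrow> ('f, 's, 'x) formula \<Rightarrow> bool" where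
  "sat T s h (FPure P) \<longleftrightarrow> holds T s P"
| "sat T s h (FSpred S) \<longleftrightarrow> sat_spred T s h S"
| "sat T s h (FStar F G) \<longleftrightarrow> (\<exists>h1 h2. heap_sum h [h1, h2] \<and> sat T s h1 F \<and> sat T s h2 G)"
| "sat T s h (FNeg F) \<longleftrightarrow> \<not> sat T s h F"
| "sat T s h (FConj F G) \<longleftrightarrow> sat T s h F \<and> sat T s h G"
| "sat T s h (FDisj F G) \<longleftrightarrow> sat T s h F \<or> sat T s h G"
| "sat T s h (FImpl F G) \<longleftrightarrow> (sat T s h F \<longrightarrow> sat T s h G)"

definition valid :: "('f, 's, 'u) struct \<Rightarrow> ('f, 's, 'x) formula \<Rightarrow> bool" where
  "valid T F \<longleftrightarrow> (\<forall>(s :: ('s, 'x, 'u) stack) h. is_stack T s \<longrightarrow> sat T s h F)"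

text \<open>An arbitrary but fixed enumeration of a multiset, used wherever a formula is
  assembled from the members of a spatial conjunction. The order does not affect its meaning.\<close>

definition enum :: "'a multiset \<Rightarrow> 'a list" where
  "enum M = (SOME xs. mset xs = M)"

fun star_list :: "('f, 's, 'x) spred list \<Rightarrow> ('f, 's, 'x) formula" where
  "star_list [] = FSpred Emp"
| "star_list [S] = FSpred S"
| "star_list (S # S' # Ss) = FStar (FSpred S) (star_list (S' # Ss))"

definition FSconj :: "('f, 's, 'x) sconj \<Rightarrow> ('f, 's, 'x) formula" where
  "FSconj \<Sigma> = star_list (enum \<Sigma>)"

definition entailment ::
  "('f, 's, 'x) expr \<Rightarrow> ('f, 's, 'x) sconj \<Rightarrow> ('f, 's, 'x) expr \<Rightarrow> ('f, 's, 'x) sconj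
   \<Rightarrow> ('f, 's, 'x) formula" where
  "entailment \<Pi> \<Sigma> \<Pi>' \<Sigma>' = FImpl (FConj (FPure \<Pi>) (FSconj \<Sigma>)) (FConj (FPure \<Pi>') (FSconj \<Sigma>'))"


section \<open>Auxiliary pure formulas\<close>

definition conj_list :: "('f, 's, 'x) expr list \<Rightarrow> ('f, 's, 'x) expr" where
  "conj_list Ps = foldr Conj Ps Top"

definition disj_list :: "('f, 's, 'x) expr list \<Rightarrow> ('f, 's, 'x) expr" where
  "disj_list Ps = foldr Disj Ps Bot"

fun empty_cond :: "('f, 's, 'x) spred \<Rightarrow> ('f, 's, 'x) expr" where
  "empty_cond Emp = Top"
| "empty_cond (Next x y) = Bot"
| "empty_cond (Lseg x y) = Eq x y"

text \<open>\<open>addr\<close>, \<open>update\<close> and \<open>check\<close> are left unspecified when an argument is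
  \<open>Emp\<close>; every use below is guarded against that.\<close>

fun addr :: "('f, 's, 'x) spred \<Rightarrow> ('f, 's, 'x) expr" where
  "addr (Next x y) = x"
| "addr (Lseg x y) = x"

definition collide :: "('f, 's, 'x) spred \<Rightarrow> ('f, 's, 'x) spred \<Rightarrow> ('f, 's, 'x) expr" where
  "collide S S' =
     (if S = Emp \<or> S' = Emp then Bot
      else Conj (Neg (empty_cond S)) (Conj (Neg (empty_cond S')) (Eq (addr S) (addr S'))))"

definition well_formed :: "('f, 's, 'x) sconj \<Rightarrow> ('f, 's, 'x) expr" where
  "well_formed \<Sigma> =
     (let Ss = enum \<Sigma>
      in conj_list [Neg (collide (Ss ! i) (Ss ! j)). j \<leftarrow> [0..<length Ss], i \<leftarrow> [0..<j]])"

definition alloc :: "('f, 's, 'x) sconj \<Rightarrow> ('f, 's, 'x) expr \<Rightarrow> ('f, 's, 'x) expr" where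
  "alloc \<Sigma> x =
     disj_list (map (\<lambda>S. if S = Emp then Bot else Conj (Neg (empty_cond S)) (Eq x (addr S)))
       (enum \<Sigma>))"

fun update :: "('f, 's, 'x) spred \<Rightarrow> ('f, 's, 'x) spred \<Rightarrow> ('f, 's, 'x) spred" where
  "update (Next x y) (Next x' z) = Emp"
| "update (Next x y) (Lseg x' z) = Lseg y z"
| "update (Lseg x y) (Next x' z) = Emp"
| "update (Lseg x y) (Lseg x' z) = Lseg y z"

fun check :: "('f, 's, 'x) sconj \<Rightarrow> ('f, 's, 'x) spred \<Rightarrow> ('f, 's, 'x) spred \<Rightarrow> ('f, 's, 'x) expr" where
  "check \<Sigma> (Next x y) (Next x' z) = Eq y z"
| "check \<Sigma> (Next x y) (Lseg x' z) = Top"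
| "check \<Sigma> (Lseg x y) (Next x' z) = Bot"
| "check \<Sigma> (Lseg x y) (Lseg x' z) = Impl (Neg (Eq y z)) (alloc \<Sigma> z)"

definition guard ::
  "('f, 's, 'x) sconj \<Rightarrow> ('f, 's, 'x) spred \<Rightarrow> ('f, 's, 'x) spred \<Rightarrow> ('f, 's, 'x) expr" where
  "guard \<Sigma> S S' =
     (if S = Emp \<or> S' = Emp then Bot else Conj (collide S S') (check \<Sigma> S S'))"


section \<open>The procedures, as nondeterministic transition systems\<close>

text \<open>In \<open>MCall Cs A B\<close> the arguments of the current recursive call are \<open>A\<close> and \<open>B\<close>, and
  \<open>Cs\<close> holds the conjuncts of the pending callers, innermost caller first: when the current
  call returns \<open>U\<close> and \<open>Cs = [C\<^sub>k, \<dots>, C\<^sub>1]\<close>, the outermost call returns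
  \<open>Conj C\<^sub>1 (\<dots> (Conj C\<^sub>k U))\<close>. The parameter \<open>\<Sigma>\<close> of \<open>match_step\<close> is
  the spatial conjunction that stays fixed throughout the recursion.\<close>

datatype ('f, 's, 'x) match_state =
    MCall "('f, 's, 'x) expr list" "('f, 's, 'x) sconj" "('f, 's, 'x) sconj"
  | MReturn "('f, 's, 'x) expr"

inductive match_step ::
  "('f, 's, 'u) struct \<Rightarrow> ('s, 'x, 'u) stack \<Rightarrow> ('f, 's, 'x) sconj
   \<Rightarrow> ('f, 's, 'x) match_state \<Rightarrow> ('f, 's, 'x) match_state \<Rightarrow> bool"
  for T :: "('f, 's, 'u) struct" and s :: "('s, 'x, 'u) stack" and \<Sigma> :: "('f, 's, 'x) sconj"
where
  empty_left:
    "match_step T s \<Sigma> (MCall Cs A B) (MCall (empty_cond S # Cs) (A - {#S#}) B)"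
    if "S \<in># A" "holds T s (empty_cond S)"
| empty_right:
    "match_step T s \<Sigma> (MCall Cs A B) (MCall (empty_cond S' # Cs) A (B - {#S'#}))"
    if "\<forall>S\<in>#A. \<not> holds T s (empty_cond S)"
       "S' \<in># B" "holds T s (empty_cond S')"
| guarded:
    "match_step T s \<Sigma> (MCall Cs A B)
       (MCall (guard \<Sigma> S S' # Cs) (A - {#S#}) ((B - {#S'#}) + {#update S S'#}))"
    if "\<forall>S\<in>#A. \<not> holds T s (empty_cond S)"
       "\<forall>S'\<in>#B. \<not> holds T s (empty_cond S')"
       "S \<in># A" "S' \<in># B" "holds T s (guard \<Sigma> S S')"
| return:
    "match_step T s \<Sigma> (MCall Cs A B)
       (MReturn (fold Conj Cs (if A = {#} \<and> B = {#} then Top else Bot)))"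
    if "\<forall>S\<in>#A. \<not> holds T s (empty_cond S)"
       "\<forall>S'\<in>#B. \<not> holds T s (empty_cond S')"
       "\<forall>S\<in>#A. \<forall>S'\<in>#B. \<not> holds T s (guard \<Sigma> S S')"

datatype verdict = Valid | Invalid

datatype ('f, 's, 'x, 'u) prove_state =
    Loop "('f, 's, 'x) expr"
  | Matching "('f, 's, 'x) expr" "('s, 'x, 'u) stack" "('f, 's, 'x) match_state"
  | Done verdict

inductive prove_step ::
  "('f, 's, 'u) struct \<Rightarrow> ('f, 's, 'x) sconj \<Rightarrow> ('f, 's, 'x) expr \<Rightarrow> ('f, 's, 'x) sconj
   \<Rightarrow> ('f, 's, 'x, 'u) prove_state \<Rightarrow> ('f, 's, 'x, 'u) prove_state \<Rightarrow> bool"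
  for T :: "('f, 's, 'u) struct" and \<Sigma> :: "('f, 's, 'x) sconj"
    and \<Pi>' :: "('f, 's, 'x) expr" and \<Sigma>' :: "('f, 's, 'x) sconj"
where
  loop_exit:
    "prove_step T \<Sigma> \<Pi>' \<Sigma>' (Loop \<Gamma>) (Done Valid)"
    if "oracle_answer T \<Gamma> None"
| loop_enter:
    "prove_step T \<Sigma> \<Pi>' \<Sigma>' (Loop \<Gamma>) (Matching \<Gamma> s (MCall [] \<Sigma> \<Sigma>'))"
    if "oracle_answer T \<Gamma> (Some s)"
| matching:
    "prove_step T \<Sigma> \<Pi>' \<Sigma>' (Matching \<Gamma> s m) (Matching \<Gamma> s m')"
    if "match_step T s \<Sigma> m m'"
| refuted:
    "prove_step T \<Sigma> \<Pi>' \<Sigma>' (Matching \<Gamma> s (MReturn U)) (Done Invalid)"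
    if "\<not> holds T s (Conj \<Pi>' U)"
| continue:
    "prove_step T \<Sigma> \<Pi>' \<Sigma>' (Matching \<Gamma> s (MReturn U)) (Loop (Conj \<Gamma> (Neg (Conj \<Pi>' U))))"
    if "holds T s (Conj \<Pi>' U)"

definition prove_init ::
  "('f, 's, 'x) expr \<Rightarrow> ('f, 's, 'x) sconj \<Rightarrow> ('f, 's, 'x, 'u) prove_state" where
  "prove_init \<Pi> \<Sigma> = Loop (Conj \<Pi> (well_formed \<Sigma>))"

text \<open>Every run is finite, whatever choices are made, and no run gets stuck before it
  has produced a verdict.\<close>

definition prove_terminates ::
  "('f, 's, 'u) struct \<Rightarrow> ('f, 's, 'x) expr \<Rightarrow> ('f, 's, 'x) sconj
   \<Rightarrow> ('f, 's, 'x) expr \<Rightarrow> ('f, 's, 'x) sconj \<Rightarrow> bool" where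
  "prove_terminates T \<Pi> \<Sigma> \<Pi>' \<Sigma>' \<longleftrightarrow>
     termip (prove_step T \<Sigma> \<Pi>' \<Sigma>') (prove_init \<Pi> \<Sigma>) \<and>
     (\<forall>c. (prove_step T \<Sigma> \<Pi>' \<Sigma>')\<^sup>*\<^sup>* (prove_init \<Pi> \<Sigma>) c \<and> (\<nexists>c'. prove_step T \<Sigma> \<Pi>' \<Sigma>' c c')
        \<longrightarrow> (\<exists>r. c = Done r))"

text \<open>This only asks for some run with verdict \<open>r\<close>. Given \<open>prove_terminates\<close>, all runs
  have verdict \<open>r\<close> iff the other verdict is not returned in this sense.\<close>

definition prove_returns ::
  "('f, 's, 'u) struct \<Rightarrow> ('f, 's, 'x) expr \<Rightarrow> ('f, 's, 'x) sconj
   \<Rightarrow> ('f, 's, 'x) expr \<Rightarrow> ('f, 's, 'x) sconj \<Rightarrow> verdict \<Rightarrow> bool" where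
  "prove_returns T \<Pi> \<Sigma> \<Pi>' \<Sigma>' r \<longleftrightarrow>
     (prove_step T \<Sigma> \<Pi>' \<Sigma>')\<^sup>*\<^sup>* (prove_init \<Pi> \<Sigma>) (Done r)"

end

theory Submission
  imports Defs
begin

text \<open>Every conjunct collected by Match justifies backwards the rewriting step that produced it, so
  a stack that satisfies the result of Match, even one computed for another stack, satisfies the
  entailment for all heaps. Conversely, if Match gets stuck on its own stack, then the remaining
  conjunctions have a countermodel, and undoing a step extends a countermodel by at most one cell;
  the new cell is available because countermodels are kept away from the addresses of the
  left conjuncts already consumed. The loop ends because Match has finitely many possible results
  for given conjunctions and each further pass of the loop rules out one of them.\<close>

section \<open>Disjoint unions of heaps\<close>

text \<open>The obstacle is that \<open>check\<close> consults \<open>alloc\<close> for the whole of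
  the original \<open>\<Sigma>\<close>, while the recursion works on what is left of it. Both
  inductions over a run of Match therefore split \<open>\<Sigma>\<close> as \<open>A + C\<close>,
  where \<open>C\<close> holds the consumed conjuncts. For soundness, a model \<open>h\<close> of
  \<open>A\<close> is considered next to a disjoint model \<open>k\<close> of \<open>C\<close>: an
  address allocated by another conjunct then lies outside the piece of heap in hand, so that gluing
  this piece to the rest of a list segment cannot create a path through its own end point. For
  completeness no model of \<open>C\<close> is built, since the heap only has to leave room for
  cells that are added later. One cell for each nonempty conjunct is always a model, because
  \<open>well_formed\<close> keeps the addresses apart; conversely, where \<open>well_formed\<close>
  fails, \<open>\<Sigma>\<close> has no model and the entailment holds trivially. This is why the
  initial \<Gamma> may contain it.\<close>

lemma disjoint_UN_iff: "X \<inter> (\<Union>k\<in>A. f k) = {} \<longleftrightarrow> (\<forall>k\<in>A. X \<inter> f k = {})"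
  by blast

lemma dom_foldr_map_add: "dom (foldr (++) hs Map.empty) = (\<Union>g\<in>set hs. dom g)"
  by (induction hs) auto

lemma heap_sum_Nil: "heap_sum h [] \<longleftrightarrow> h = Map.empty"
  by (simp add: heap_sum_def)

text \<open>Pairwise disjointness splits into that of the tail and that of the head against each
  member of the tail; the latter amounts to disjointness from the sum of the tail.\<close>

lemma heap_sum_Cons:
  "heap_sum h (g # gs) \<longleftrightarrow> (\<exists>h'. heap_sum h' gs \<and> dom g \<inter> dom h' = {} \<and> h = g ++ h')"
proof -
  have "(\<forall>i j. i < j \<and> j < length (g # gs) \<longrightarrow> dom ((g # gs) ! i) \<inter> dom ((g # gs) ! j) = {}) \<longleftrightarrow>
      (\<forall>i j. i < j \<and> j < length gs \<longrightarrow> dom (gs ! i) \<inter> dom (gs ! j) = {}) \<and>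
      (\<forall>k<length gs. dom g \<inter> dom (gs ! k) = {})" (is "?L \<longleftrightarrow> ?R1 \<and> ?R2")
  proof (intro iffI conjI allI impI)
    fix i j assume L: ?L and "i < j \<and> j < length gs"
    with L[rule_format, of "Suc i" "Suc j"] show "dom (gs ! i) \<inter> dom (gs ! j) = {}"
      by simp
  next
    fix k assume L: ?L and "k < length gs"
    with L[rule_format, of 0 "Suc k"] show "dom g \<inter> dom (gs ! k) = {}"
      by simp
  next
    fix i j assume "?R1 \<and> ?R2" "i < j \<and> j < length (g # gs)"
    then show "dom ((g # gs) ! i) \<inter> dom ((g # gs) ! j) = {}"
      by (cases i; cases j) auto
  qed
  moreover have "?R2 \<longleftrightarrow> dom g \<inter> dom (foldr (++) gs Map.empty) = {}"
  proof -
    have "?R2 \<longleftrightarrow> (\<forall>k\<in>set gs. dom g \<inter> dom k = {})"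
      unfolding all_set_conv_all_nth ..
    also have "\<dots> \<longleftrightarrow> dom g \<inter> dom (foldr (++) gs Map.empty) = {}"
      unfolding dom_foldr_map_add by (rule disjoint_UN_iff[symmetric])
    finally show ?thesis .
  qed
  ultimately show ?thesis
    by (auto simp: heap_sum_def)
qed

lemma map_le_map_add_left: "dom g \<inter> dom h = {} \<Longrightarrow> g \<subseteq>\<^sub>m g ++ h"
  by (metis map_add_comm map_le_map_add)

lemma map_add_left_comm_disjoint:
  "dom f \<inter> dom g = {} \<Longrightarrow> f ++ (g ++ h) = g ++ (f ++ h)"
  by (metis map_add_assoc map_add_comm)

section \<open>List segments\<close>

text \<open>Recursive form of \<open>lseg\<close> that peels off the first cell, the end at which
  Match consumes segments. The end point is compared at every cell, so paths through it, and cycles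
  in particular, are excluded.\<close>

inductive seg :: "int \<Rightarrow> 'u heap \<Rightarrow> int \<Rightarrow> bool" where
  seg_nil: "seg b Map.empty b"
| seg_cons: "a \<noteq> b \<Longrightarrow> h a = None \<Longrightarrow> seg c h b \<Longrightarrow> seg a (h(a \<mapsto> VInt c)) b"

abbreviation path_heap :: "(nat \<Rightarrow> int) \<Rightarrow> nat \<Rightarrow> 'u heap list" where
  "path_heap p n \<equiv> map (\<lambda>i. [p i \<mapsto> VInt (p (Suc i))]) [0..<n]"

lemma path_heap_Suc:
  "path_heap p (Suc n) = [p 0 \<mapsto> VInt (p 1)] # path_heap (\<lambda>i. p (Suc i)) n"
  by (simp add: upt_conv_Cons map_Suc_upt[symmetric] o_def del: upt_Suc)

lemma seg_iff_path:
  "seg a h b \<longleftrightarrow>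
    (\<exists>n p. p 0 = a \<and> p n = b \<and> (\<forall>i<n. p i \<noteq> b) \<and> heap_sum h (path_heap p n))"
proof
  assume "seg a h b"
  then show "\<exists>n p. p 0 = a \<and> p n = b \<and> (\<forall>i<n. p i \<noteq> b) \<and> heap_sum h (path_heap p n)"
  proof induction
    case (seg_nil b)
    show ?case by (rule exI[of _ 0]) (auto simp: heap_sum_Nil)
  next
    case (seg_cons a b h c)
    then obtain n p where p: "p 0 = c" "p n = b" "\<forall>i<n. p i \<noteq> b" "heap_sum h (path_heap p n)"
      by blast
    have "heap_sum (h(a \<mapsto> VInt c)) (path_heap (case_nat a p) (Suc n))"
      unfolding path_heap_Suc heap_sum_Cons using p seg_cons.hyps
      by (intro exI[of _ h]) (auto simp: map_add_def fun_eq_iff split: option.split)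
    moreover have "\<forall>i<Suc n. case_nat a p i \<noteq> b"
      using p seg_cons.hyps by (auto split: nat.split)
    moreover have "case_nat a p 0 = a" "case_nat a p (Suc n) = b"
      using p by simp_all
    ultimately show ?case by blast
  qed
next
  assume "\<exists>n p. p 0 = a \<and> p n = b \<and> (\<forall>i<n. p i \<noteq> b) \<and> heap_sum h (path_heap p n)"
  then obtain n p where
    "p 0 = a" "p n = b" "\<forall>i<n. p i \<noteq> b" "heap_sum h (path_heap p n)" by blast
  then show "seg a h b"
  proof (induction n arbitrary: a p h)
    case 0
    then show ?case by (auto simp: heap_sum_Nil intro: seg_nil)
  next
    case (Suc n)
    from Suc.prems(4) obtain h' where h': "heap_sum h' (path_heap (\<lambda>i. p (Suc i)) n)"
      "p 0 \<notin> dom h'" "h = [p 0 \<mapsto> VInt (p 1)] ++ h'"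
      unfolding path_heap_Suc heap_sum_Cons by auto
    have "seg (p 1) h' b"
      using Suc.prems by (intro Suc.IH[OF _ _ _ h'(1)]) auto
    moreover have "h = h'(a \<mapsto> VInt (p 1))"
      using h'(2,3) Suc.prems(1) by (auto simp: map_add_def fun_eq_iff split: option.split)
    moreover have "h' a = None" "a \<noteq> b"
      using Suc.prems(1,3) h'(2) by auto
    ultimately show ?case
      using seg_cons by metis
  qed
qed

lemma seg_end_notin_dom: "seg a h b \<Longrightarrow> b \<notin> dom h"
  by (induction rule: seg.induct) auto

lemma seg_refl_iff: "seg a h a \<longleftrightarrow> h = Map.empty"
  by (auto elim: seg.cases intro: seg_nil)

lemma seg_uncons:
  assumes "seg a h b" "a \<noteq> b"
  obtains c where "h a = Some (VInt c)" "seg c (h(a := None)) b"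
  using assms by cases (auto simp: fun_upd_idem)

lemma seg_cell: "a \<noteq> b \<Longrightarrow> seg a [a \<mapsto> VInt b] b"
  using seg_cons[of a b Map.empty b] seg_nil by auto

text \<open>The condition on \<open>c\<close> is the crux: otherwise the joined path could meet its
  end point inside \<open>h\<close>, which \<open>lseg\<close> forbids. Securing it is the purpose
  of \<open>alloc\<close> in \<open>check\<close>.\<close>

lemma seg_append:
  "seg a h b \<Longrightarrow> seg b g c \<Longrightarrow> dom h \<inter> dom g = {} \<Longrightarrow> c \<notin> dom h \<Longrightarrow> seg a (h ++ g) c"
proof (induction rule: seg.induct)
  case (seg_cons a b h d)
  have "a \<noteq> c" "a \<notin> dom g" "dom h \<inter> dom g = {}" "c \<notin> dom h"
    using seg_cons.prems(2,3) by (auto simp del: fun_upd_apply)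
  moreover from this have "seg d (h ++ g) c" "(h ++ g) a = None"
    using seg_cons.IH seg_cons.prems(1) seg_cons.hyps(2) by auto
  ultimately
show ?case
    using seg.seg_cons[of a c "h ++ g" d] by (simp add: map_add_upd_left del: fun_upd_apply)
qed simp

text \<open>The first cell of both segments sits at \<open>a\<close>, hence in the common domain, so
  both continue at the same address; the rest follows by induction.\<close>

lemma seg_unique:
  "seg a g b \<Longrightarrow> seg a h b \<Longrightarrow> \<forall>c \<in> dom g \<inter> dom h. g c = h c \<Longrightarrow> g = h"
proof (induction arbitrary: h rule: seg.induct)
  case (seg_nil b)
  then show ?case by (simp add: seg_refl_iff)
next
  case (seg_cons a b g c)
  from seg_cons.prems(1) seg_cons.hyps(1) obtain d
    where d: "h a = Some (VInt d)" "seg d (h(a := None)) b"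
    by (rule seg_uncons)
  have "d = c"
    using seg_cons.prems(2) d(1) by (auto dest: bspec[of _ _ a])
  have "\<forall>e \<in> dom g \<inter> dom (h(a := None)). g e = (h(a := None)) e"
    using seg_cons.prems(2) seg_cons.hyps(2)
    by (metis (no_types, lifting) Int_iff domIff fun_upd_apply)
  with d(2) have "g = h(a := None)"
    unfolding \<open>d = c\<close> by (rule seg_cons.IH)
  then show ?case using d \<open>d = c\<close> by auto
qed

lemma sat_Lseg_iff:
  "sat_spred T s h (Lseg x z) \<longleftrightarrow>
    (\<exists>a b. eval T s x = VInt a \<and> eval T s z = VInt b \<and> seg a h b)"
proof
  assume "sat_spred T s h (Lseg x z)"
  then obtain n p where p: "VInt (p 0) = eval T s x" "VInt (p n) = eval T s z"
    "\<forall>i<n. VInt (p i) \<noteq> eval T s z" "heap_sum h (path_heap p n)"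
    by auto
  moreover have "\<forall>i<n. p i \<noteq> p n"
    using p(2,3) by auto
  ultimately have "seg (p 0) h (p n)"
    unfolding seg_iff_path by blast
  with p show "\<exists>a b. eval T s x = VInt a \<and> eval T s z = VInt b \<and> seg a h b"
    by metis
next
  assume "\<exists>a b. eval T s x = VInt a \<and> eval T s z = VInt b \<and> seg a h b"
  then obtain n p where "eval T s x = VInt (p 0)" "eval T s z = VInt (p n)"
    "\<forall>i<n. p i \<noteq> p n" "heap_sum h (path_heap p n)"
    unfolding seg_iff_path by blast
  then show "sat_spred T s h (Lseg x z)"
    by (auto intro!: exI[of _ n] exI[of _ p])
qed

section \<open>Satisfaction of spatial conjunctions\<close>

lemma mset_enum: "mset (enum M) = M"
  unfolding enum_def by (rule someI_ex[OF ex_mset])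

fun sat_list ::
  "('f, 's, 'u) struct \<Rightarrow> ('s, 'x, 'u) stack \<Rightarrow> 'u heap \<Rightarrow> ('f, 's, 'x) spred list \<Rightarrow> bool" where
  "sat_list T s h [] \<longleftrightarrow> h = Map.empty"
| "sat_list T s h (S # Ss) \<longleftrightarrow>
    (\<exists>g k. dom g \<inter> dom k = {} \<and> h = g ++ k \<and> sat_spred T s g S \<and> sat_list T s k Ss)"

text \<open>\<open>star_list\<close> stops at a singleton whereas \<open>sat_list\<close> goes on to
  the empty list; the additional summand is the empty heap.\<close>

lemma sat_star_list: "sat T s h (star_list Ss) \<longleftrightarrow> sat_list T s h Ss"
  by (induction Ss arbitrary: h rule: star_list.induct) (auto simp: heap_sum_Cons heap_sum_Nil)

lemma sat_list_remove1:
  "S \<in> set Ss \<Longrightarrow> sat_list T s h Ss \<longleftrightarrow> sat_list T s h (S # remove1 S Ss)"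
proof (induction Ss arbitrary: h)
  case (Cons S' Ss)
  show ?case
  proof (cases "S = S'")
    case False
    with Cons have IH: "sat_list T s k Ss \<longleftrightarrow> sat_list T s k (S # remove1 S Ss)" for k
      by simp
    have "sat_list T s h (S # S' # R) \<Longrightarrow> sat_list T s h (S' # S # R)" for S S' R
    proof -
      assume "sat_list T s h (S # S' # R)"
      then obtain g g' k where *: "dom g \<inter> dom (g' ++ k) = {}" "dom g' \<inter> dom k = {}"
        "h = g ++ (g' ++ k)" "sat_spred T s g S" "sat_spred T s g' S'" "sat_list T s k R"
        by auto
      then have "dom g \<inter> dom g' = {}" by auto
      from map_add_left_comm_disjoint[OF this] *(3) have "h = g' ++ (g ++ k)" by simp
      moreover have "dom g' \<inter> dom (g ++ k) = {}" "dom g \<inter> dom k = {}" using * by auto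
      ultimately show ?thesis using *(4-6) unfolding sat_list.simps by blast
    qed
    then have "sat_list T s h (S' # S # remove1 S Ss) \<longleftrightarrow> sat_list T s h (S # S' # remove1 S Ss)"
      by blast
    moreover have "sat_list T s h (S' # Ss) \<longleftrightarrow> sat_list T s h (S' # S # remove1 S Ss)"
      using IH by (simp del: sat_list.simps(2) add: sat_list.simps(2)[of _ _ _ S'])
    ultimately show ?thesis using False by simp
  qed simp
qed simp

lemma sat_list_cong_mset:
  "mset Ss = mset Ss' \<Longrightarrow> sat_list T s h Ss \<longleftrightarrow> sat_list T s h Ss'"
proof (induction Ss arbitrary: Ss' h)
  case (Cons S Ss)
  then have "S \<in> set Ss'" by (metis list.set_intros(1) mset_eq_setD)
  from Cons.prems have "mset Ss = mset (remove1 S Ss')"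
    by (metis mset_remove1 remove1.simps(2))
  then have "sat_list T s k Ss \<longleftrightarrow> sat_list T s k (remove1 S Ss')" for k
    by (rule Cons.IH)
  with sat_list_remove1[OF \<open>S \<in> set Ss'\<close>, of T s h] show ?case by simp
qed simp

text \<open>Hides the arbitrary order chosen by \<open>enum\<close>: \<open>msat_empty\<close> and
  \<open>msat_add_mset\<close> describe satisfaction by the multiset alone.\<close>

definition msat ::
  "('f, 's, 'u) struct \<Rightarrow> ('s, 'x, 'u) stack \<Rightarrow> 'u heap \<Rightarrow> ('f, 's, 'x) sconj \<Rightarrow> bool" where
  "msat T s h M \<longleftrightarrow> sat_list T s h (enum M)"

lemma sat_FSconj: "sat T s h (FSconj M) \<longleftrightarrow> msat T s h M"
  by (simp add: FSconj_def msat_def sat_star_list)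

lemma enum_empty: "enum {#} = []"
  using mset_enum[of "{#}"] by simp

lemma msat_empty: "msat T s h {#} \<longleftrightarrow> h = Map.empty"
  by (simp add: msat_def enum_empty)

lemma msat_add_mset:
  "msat T s h (add_mset S M) \<longleftrightarrow>
    (\<exists>g k. dom g \<inter> dom k = {} \<and> h = g ++ k \<and> sat_spred T s g S \<and> msat T s k M)"
proof -
  have "sat_list T s h (enum (add_mset S M)) \<longleftrightarrow> sat_list T s h (S # enum M)"
    by (rule sat_list_cong_mset) (simp add: mset_enum)
  then show ?thesis by (simp add: msat_def)
qed

lemma msat_dom_obtain:
  assumes "msat T s h M" "a \<in> dom h"
  obtains S g where "S \<in># M" "sat_spred T s g S" "g \<subseteq>\<^sub>m h" "a \<in> dom g"
  using assms
proof (induction M arbitrary: h thesis)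
  case empty
  then show ?case by (simp add: msat_empty)
next
  case (add S M)
  from add.prems(2) obtain g k where
    *: "dom g \<inter> dom k = {}" "h = g ++ k" "sat_spred T s g S" "msat T s k M"
    by (auto simp: msat_add_mset)
  have le: "g \<subseteq>\<^sub>m h" "k \<subseteq>\<^sub>m h" using *(1,2)
    by (simp_all add: map_le_map_add_left)
  show ?case
  proof (cases "a \<in> dom g")
    case True
    with * le show ?thesis by (intro add.prems(1)[of S g]) auto
  next
    case False
    with add.prems(3) * have "a \<in> dom k" by auto
    with *(4) obtain S' g' where "S' \<in># M" "sat_spred T s g' S'" "g' \<subseteq>\<^sub>m k" "a \<in> dom g'"
      by (rule add.IH[rotated])
    with le show ?thesis by (intro add.prems(1)[of S' g']) (auto intro: map_le_trans)
  qed
qed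

lemma msat_member_obtain:
  assumes "msat T s h M" "S \<in># M"
  obtains g where "sat_spred T s g S" "g \<subseteq>\<^sub>m h"
proof -
  from assms(2) obtain M' where "M = add_mset S M'" by (metis insert_DiffM)
  with assms(1) obtain g k where "dom g \<inter> dom k = {}" "h = g ++ k" "sat_spred T s g S"
    by (auto simp: msat_add_mset)
  then show ?thesis by (intro that[of g]) (simp_all add: map_le_map_add_left)
qed

section \<open>Truth of the auxiliary pure formulas\<close>

lemma holds_simps:
  "holds T s (Eq a b) \<longleftrightarrow> eval T s a = eval T s b"
  "holds T s Top"
  "\<not> holds T s Bot"
  "holds T s (Neg P) \<longleftrightarrow> \<not> holds T s P"
  "holds T s (Conj P Q) \<longleftrightarrow> holds T s P \<and> holds T s Q"
  "holds T s (Disj P Q) \<longleftrightarrow> holds T s P \<or> holds T s Q"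
  "holds T s (Impl P Q) \<longleftrightarrow> (holds T s P \<longrightarrow> holds T s Q)"
  by (auto simp: holds_def)

lemma holds_conj_list: "holds T s (conj_list Ps) \<longleftrightarrow> (\<forall>P\<in>set Ps. holds T s P)"
  unfolding conj_list_def by (induction Ps) (auto simp: holds_simps)

lemma holds_disj_list: "holds T s (disj_list Ps) \<longleftrightarrow> (\<exists>P\<in>set Ps. holds T s P)"
  unfolding disj_list_def by (induction Ps) (auto simp: holds_simps)

lemma holds_fold_Conj: "holds T s (fold Conj Cs P) \<longleftrightarrow> (\<forall>C\<in>set Cs. holds T s C) \<and> holds T s P"
  by (induction Cs arbitrary: P) (auto simp: holds_simps)

definition nonempty ::
  "('f, 's, 'u) struct \<Rightarrow> ('s, 'x, 'u) stack \<Rightarrow> ('f, 's, 'x) spred \<Rightarrow> bool" where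
  "nonempty T s S \<longleftrightarrow> \<not> holds T s (empty_cond S)"

text \<open>Common semantic core of \<open>collide\<close> and \<open>alloc\<close>. Requiring
  nonemptiness also makes it false for \<open>Emp\<close>, where \<open>addr\<close> is
  unspecified.\<close>

definition starts_at ::
  "('f, 's, 'u) struct \<Rightarrow> ('s, 'x, 'u) stack \<Rightarrow> ('f, 's, 'x) spred \<Rightarrow> int \<Rightarrow> bool" where
  "starts_at T s S a \<longleftrightarrow> nonempty T s S \<and> eval T s (addr S) = VInt a"

lemma nonempty_simps:
  "\<not> nonempty T s Emp"
  "nonempty T s (Next x y)"
  "nonempty T s (Lseg x y) \<longleftrightarrow> eval T s x \<noteq> eval T s y"
  by (simp_all add: nonempty_def holds_simps)

lemma starts_at_simps:
  "\<not> starts_at T s Emp a"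
  "starts_at T s (Next x y) a \<longleftrightarrow> eval T s x = VInt a"
  "starts_at T s (Lseg x y) a \<longleftrightarrow> eval T s x = VInt a \<and> eval T s y \<noteq> VInt a"
  by (auto simp: starts_at_def nonempty_simps)

lemma holds_collide:
  "holds T s (collide S S') \<longleftrightarrow>
    nonempty T s S \<and> nonempty T s S' \<and> eval T s (addr S) = eval T s (addr S')"
  by (cases S; cases S') (auto simp: collide_def holds_simps nonempty_simps)

lemma holds_guard:
  "holds T s (guard \<Sigma> S S') \<longleftrightarrow> holds T s (collide S S') \<and> holds T s (check \<Sigma> S S')"
  by (auto simp: guard_def holds_simps collide_def)

lemma holds_alloc:
  "holds T s (alloc \<Sigma> x) \<longleftrightarrow> (\<exists>S\<in>#\<Sigma>. nonempty T s S \<and> eval T s x = eval T s (addr S))"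
proof -
  have *: "holds T s (if S = Emp then Bot else Conj (Neg (empty_cond S)) (Eq x (addr S))) \<longleftrightarrow>
      nonempty T s S \<and> eval T s x = eval T s (addr S)" for S
    by (cases S) (simp_all add: holds_simps nonempty_def)
  have "set (enum \<Sigma>) = set_mset \<Sigma>" by (metis mset_enum set_mset_mset)
  then show ?thesis
    by (simp add: alloc_def holds_disj_list * del: if_image_distrib)
qed

text \<open>Trades pairs of distinct positions for a decomposition of the multiset, which frees
  \<open>well_formed\<close> from the order of \<open>enum\<close>. Distinct positions may hold
  equal conjuncts, hence positions and not members are compared.\<close>

lemma add_mset2_mset_iff:
  "(\<exists>M. mset xs = add_mset x (add_mset y M)) \<longleftrightarrow>
    (\<exists>i j. i < length xs \<and> j < length xs \<and> i \<noteq> j \<and> xs ! i = x \<and> xs ! j = y)"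
proof
  assume "\<exists>M. mset xs = add_mset x (add_mset y M)"
  then obtain M where M: "mset xs = add_mset x (add_mset y M)" by blast
  then have "x \<in> set xs" by (metis set_mset_mset union_single_eq_member)
  then obtain i where i: "i < length xs" "xs ! i = x" by (auto simp: in_set_conv_nth)
  have xs: "xs = take i xs @ x # drop (Suc i) xs"
    using i id_take_nth_drop by blast
  have "mset xs = add_mset x (mset (take i xs @ drop (Suc i) xs))"
    by (subst xs) simp
  with M have "y \<in># mset (take i xs @ drop (Suc i) xs)" by simp
  then have "y \<in> set (take i xs @ drop (Suc i) xs)"
    by (simp only: set_mset_mset)
  then consider j where "j < i" "xs ! j = y" | j where "j < length xs - Suc i" "xs ! (Suc i + j) = y"
    using i by (auto simp: in_set_conv_nth)
  then show "\<exists>i j. i < length xs \<and> j < length xs \<and> i \<noteq> j \<and> xs ! i = x \<and> xs ! j = y"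
  proof cases
    case (1 j)
    with i show ?thesis by (intro exI[of _ i] exI[of _ j]) simp
  next
    case (2 j)
    with i show ?thesis by (intro exI[of _ i] exI[of _ "Suc i + j"]) simp
  qed
next
  assume "\<exists>i j. i < length xs \<and> j < length xs \<and> i \<noteq> j \<and> xs ! i = x \<and> xs ! j = y"
  then obtain i j where ij: "i < length xs" "j < length xs" "i \<noteq> j" "xs ! i = x" "xs ! j = y"
    by blast
  have "mset xs = image_mset ((!) xs) (mset_set {..<length xs})"
    by (metis mset_map map_nth mset_set_upto_eq_mset_upto lessThan_atLeast0)
  moreover obtain D where "finite D" "i \<notin> D" "j \<notin> D" "{..<length xs} = insert i (insert j D)"
    by (rule that[of "{..<length xs} - {i, j}"]) (use ij in auto)
  ultimately have "mset xs = add_mset x (add_mset y (image_mset ((!) xs) (mset_set D)))"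
    using ij by simp
  then show "\<exists>M. mset xs = add_mset x (add_mset y M)" by blast
qed

lemma holds_well_formed:
  "holds T s (well_formed \<Sigma>) \<longleftrightarrow>
    (\<forall>S S' M. \<Sigma> = add_mset S (add_mset S' M) \<longrightarrow> \<not> holds T s (collide S S'))"
proof -
  let ?xs = "enum \<Sigma>"
  have sym: "holds T s (collide S S') \<longleftrightarrow> holds T s (collide S' S)" for S S'
    by (auto simp: holds_collide)
  have "holds T s (well_formed \<Sigma>) \<longleftrightarrow>
      (\<forall>j<length ?xs. \<forall>i<j. \<not> holds T s (collide (?xs ! i) (?xs ! j)))"
    by (auto simp: well_formed_def Let_def holds_conj_list holds_simps)
  also have "\<dots> \<longleftrightarrow> (\<forall>i j. i < length ?xs \<and> j < length ?xs \<and> i \<noteq> j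
      \<longrightarrow> \<not> holds T s (collide (?xs ! i) (?xs ! j)))"
  proof (intro iffI allI impI)
    fix i j
    assume *: "\<forall>j<length ?xs. \<forall>i<j. \<not> holds T s (collide (?xs ! i) (?xs ! j))"
      and ij: "i < length ?xs \<and> j < length ?xs \<and> i \<noteq> j"
    then consider "i < j" | "j < i" by linarith
    then show "\<not> holds T s (collide (?xs ! i) (?xs ! j))"
    proof cases
      case 2
      with * ij have "\<not> holds T s (collide (?xs ! j) (?xs ! i))" by blast
      then show ?thesis by (subst sym)
    qed (use * ij in blast)
  next
    fix i j
    assume *: "\<forall>i j. i < length ?xs \<and> j < length ?xs \<and> i \<noteq> j
        \<longrightarrow> \<not> holds T s (collide (?xs ! i) (?xs ! j))" and "j < length ?xs" "i < j"
    then have "i < length ?xs" "i \<noteq> j" by linarith+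
    with * \<open>j < length ?xs\<close> show "\<not> holds T s (collide (?xs ! i) (?xs ! j))" by blast
  qed
  also have "\<dots> \<longleftrightarrow> (\<forall>S S'. (\<exists>M. mset ?xs = add_mset S (add_mset S' M))
      \<longrightarrow> \<not> holds T s (collide S S'))"
    unfolding add_mset2_mset_iff by blast
  finally show ?thesis by (simp add: mset_enum)
qed

section \<open>Spatial predicates under a fixed stack\<close>

text \<open>The stack stays fixed in the induction: equations, connectives and quantifiers evaluate
  to a \<open>VBool\<close> by definition, so the modified stacks below a quantifier need not be
  examined.\<close>

lemma eval_in_carrier:
  assumes "wf_struct T"
  shows "has_sort T e \<sigma> \<Longrightarrow> is_stack T s \<Longrightarrow> eval T s e \<in> carrier T \<sigma>"
proof (induction rule: has_sort.induct)
  case (1 x \<sigma>)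
  then show ?case by (auto simp: is_stack_def split: prod.splits)
next
  case (2 es f)
  then have "list_all2 (\<lambda>v \<sigma>. v \<in> carrier T \<sigma>) (map (eval T s) es) (fst (rank T f))"
    by (auto simp: list_all2_conv_all_nth)
  with assms show ?case by (simp add: wf_struct_def)
qed auto

locale struct_stack =
  fixes T :: "('f, 's, 'u) struct" and s :: "('s, 'x, 'u) stack"
  assumes wf_struct: "wf_struct T" and is_stack: "is_stack T s"
begin

lemma eval_IntS:
  assumes "has_sort T e IntS"
  obtains a where "eval T s e = VInt a"
  using eval_in_carrier[OF wf_struct assms is_stack] by auto

lemma wf_spred_cases:
  assumes "wf_spred T S"
  obtains "S = Emp"
  | x y a b where "S = Next x y" "eval T s x = VInt a" "eval T s y = VInt b"
  | x y a b where "S = Lseg x y" "eval T s x = VInt a" "eval T s y = VInt b"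
  using assms by (cases S) (auto elim!: eval_IntS)

lemma nonempty_starts_at:
  assumes "wf_spred T S" "nonempty T s S"
  obtains a where "starts_at T s S a"
  using assms(1)
  by (rule wf_spred_cases) (use assms(2) that in \<open>auto simp: nonempty_simps starts_at_simps\<close>)

lemma sat_spred_empty_iff:
  assumes "wf_spred T S" "\<not> nonempty T s S"
  shows "sat_spred T s h S \<longleftrightarrow> h = Map.empty"
  using assms(1)
  by (rule wf_spred_cases)
    (use assms(2) in \<open>auto simp: nonempty_simps sat_Lseg_iff seg_refl_iff simp del: sat_spred.simps(3)\<close>)

lemma sat_spred_starts_at:
  assumes "starts_at T s S a" "sat_spred T s h S"
  shows "a \<in> dom h"
proof (cases S)
  case (Lseg x y)
  with assms obtain b where "seg a h b" "a \<noteq> b"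
    by (auto simp: starts_at_simps sat_Lseg_iff simp del: sat_spred.simps(3))
  then show ?thesis by (rule seg_uncons) auto
qed (use assms in \<open>auto simp: starts_at_simps\<close>)

lemma sat_spred_unique:
  assumes "sat_spred T s g S" "sat_spred T s h S" "\<forall>a \<in> dom g \<inter> dom h. g a = h a"
  shows "g = h"
proof (cases S)
  case (Lseg x y)
  with assms obtain a b where "seg a g b" "seg a h b"
    by (auto simp: sat_Lseg_iff simp del: sat_spred.simps(3))
  then show ?thesis using assms(3) by (rule seg_unique)
qed (use assms in auto)

text \<open>Content of the only cell in the smallest model of a nonempty predicate; for
  \<open>Lseg\<close> this is the segment of length one.\<close>

fun target :: "('f, 's, 'x) spred \<Rightarrow> 'u val" where
  "target Emp = undefined"
| "target (Next x y) = eval T s y"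
| "target (Lseg x y) = eval T s y"

lemma sat_spred_cell:
  assumes "wf_spred T S" "starts_at T s S a"
  shows "sat_spred T s [a \<mapsto> target S] S"
  using assms(1)
proof (rule wf_spred_cases)
  fix x y c d
  assume S: "S = Lseg x y" "eval T s x = VInt c" "eval T s y = VInt d"
  with assms(2) have "c = a" "a \<noteq> d" by (auto simp: starts_at_simps)
  with S seg_cell[of a d] show ?thesis
    by (simp add: sat_Lseg_iff del: sat_spred.simps(3))
qed (use assms(2) in \<open>auto simp: starts_at_simps\<close>)

lemma guard_starts_at:
  assumes "wf_spred T S" "holds T s (guard \<Sigma> S S')"
  obtains a where "starts_at T s S a" "starts_at T s S' a"
proof -
  from assms(2) have "nonempty T s S" "nonempty T s S'" "eval T s (addr S) = eval T s (addr S')"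
    by (auto simp: holds_guard holds_collide)
  with assms(1) that show ?thesis by (auto simp: starts_at_def elim: nonempty_starts_at)
qed

text \<open>The hypothesis \<open>avoid\<close> holds when the other conjuncts of \<open>\<Sigma>\<close> own cells outside \<open>g\<close>. It keeps the end
  point of \<open>S'\<close>, allocated by \<open>check\<close>, out of the piece \<open>g\<close>.\<close>

lemma sat_spred_update_glue:
  assumes "wf_spred T S" "wf_spred T S'" "holds T s (guard \<Sigma> S S')"
    and "sat_spred T s g S" "sat_spred T s k (update S S')" "dom g \<inter> dom k = {}"
    and avoid: "\<And>S0 a. S0 \<in># \<Sigma> \<Longrightarrow> starts_at T s S0 a \<Longrightarrow> a \<in> dom g \<Longrightarrow> S0 = S"
  shows "sat_spred T s (g ++ k) S'"
proof -
  have col: "eval T s (addr S) = eval T s (addr S')" "nonempty T s S" "nonempty T s S'"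
    and chk: "holds T s (check \<Sigma> S S')"
    using assms(3) by (auto simp: holds_guard holds_collide)
  from assms(1) col(2) obtain a where a: "starts_at T s S a" by (rule nonempty_starts_at)
  with col have a': "starts_at T s S' a" by (simp add: starts_at_def)
  show ?thesis
    using assms(2)
  proof (rule wf_spred_cases)
    assume "S' = Emp"
    with col show ?thesis by (simp add: nonempty_simps)
  next
    fix x' z c b
    assume S': "S' = Next x' z" "eval T s x' = VInt c" "eval T s z = VInt b"
    with col chk assms(4,5) show ?thesis
      by (cases S) (auto simp: nonempty_simps holds_simps)
  next
    fix x' z c b
    assume S': "S' = Lseg x' z" "eval T s x' = VInt c" "eval T s z = VInt b"
    with a' have "c = a" "a \<noteq> b" by (auto simp: starts_at_simps)
    from assms(1) have "seg a (g ++ k) b"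
    proof (rule wf_spred_cases)
      assume "S = Emp"
      with col show ?thesis by (simp add: nonempty_simps)
    next
      fix x y e d
      assume S: "S = Next x y" "eval T s x = VInt e" "eval T s y = VInt d"
      then have "g = [a \<mapsto> VInt d]" "seg d k b"
        using assms(4,5) a S'
        by (auto simp: starts_at_simps sat_Lseg_iff simp del: sat_spred.simps(3))
      moreover have "[a \<mapsto> VInt d] ++ k = k(a \<mapsto> VInt d)" "k a = None"
        using assms(6) \<open>g = _\<close> map_add_comm[of g k] by (auto simp: map_add_def)
      ultimately show ?thesis using seg_cons[of a b k d] \<open>a \<noteq> b\<close> by metis
    next
      fix x y e d
      assume S: "S = Lseg x y" "eval T s x = VInt e" "eval T s y = VInt d"
      with assms(4,5) a S' have g: "seg a g d" and k: "seg d k b"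
        by (auto simp: starts_at_simps sat_Lseg_iff simp del: sat_spred.simps(3))
      have "b \<notin> dom g"
      proof (cases "d = b")
        case True
        with g show ?thesis by (simp add: seg_end_notin_dom)
      next
        case False
        with chk S S' obtain S0 where "S0 \<in># \<Sigma>" "starts_at T s S0 b"
          by (auto simp: holds_simps holds_alloc starts_at_def)
        \<comment> \<open>The conjunct that allocates \<open>b\<close> is not \<open>S\<close>,
          which starts at \<open>a\<close>; so \<open>avoid\<close> keeps \<open>b\<close> out of
          \<open>g\<close>.\<close>
        moreover have "\<not> starts_at T s S b" using a \<open>a \<noteq> b\<close> by (auto simp: starts_at_def)
        ultimately show ?thesis using avoid by blast
      qed
      with g k assms(6) show ?thesis by (intro seg_append)
    qed
    with S' \<open>c = a\<close> show ?thesis by (simp add: sat_Lseg_iff del: sat_spred.simps(3))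
  qed
qed

text \<open>Partial converse of \<open>sat_spred_update_glue\<close> for a piece of exactly one
  cell: if the first cell of \<open>S'\<close> is the smallest model of \<open>S\<close>, the
  remainder satisfies the update.\<close>

lemma sat_spred_update_cut:
  assumes "wf_spred T S" "wf_spred T S'" "holds T s (guard \<Sigma> S S')" "starts_at T s S a"
    and "sat_spred T s h S'" "h a = Some (target S)"
  shows "sat_spred T s (h(a := None)) (update S S')"
proof -
  have col: "eval T s (addr S) = eval T s (addr S')" "nonempty T s S" "nonempty T s S'"
    and chk: "holds T s (check \<Sigma> S S')"
    using assms(3) by (auto simp: holds_guard holds_collide)
  show ?thesis
  proof (cases S')
    case Emp
    with col show ?thesis by (simp add: nonempty_simps)
  next
    case (Next x' z)
    with col chk assms(4,5) show ?thesis
      by (cases S) (auto simp: starts_at_def nonempty_simps holds_simps)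
  next
    case (Lseg x' z)
    with assms(5) obtain b where b: "eval T s z = VInt b" "seg a h b"
      using col assms(4) by (auto simp: sat_Lseg_iff starts_at_def simp del: sat_spred.simps(3))
    moreover have "a \<noteq> b"
      using col(1,3) b(1) Lseg assms(4) by (auto simp: nonempty_simps starts_at_def)
    ultimately obtain c where c: "h a = Some (VInt c)" "seg c (h(a := None)) b"
      using seg_uncons by blast
    obtain y where "eval T s y = VInt c" "update S S' = Lseg y z"
      using c(1) assms(6) col(2) Lseg by (cases S) (auto simp: nonempty_simps)
    with c b show ?thesis by (simp add: sat_Lseg_iff del: sat_spred.simps(3))
  qed
qed

section \<open>Countermodels of stuck calls\<close>

text \<open>Guarantees that a fresh address is available for a detour.\<close>

lemma finite_starts_at: "finite {a. \<exists>S\<in>#\<Sigma>. starts_at T s S a}"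
proof -
  have "finite {a. starts_at T s S a}" for S
  proof (rule finite_subset)
    show "{a. starts_at T s S a} \<subseteq> VInt -` {eval T s (addr S)}"
      by (auto simp: starts_at_def)
    show "finite (VInt -` {eval T s (addr S)})"
      by (rule finite_vimageI) (auto simp: inj_def)
  qed
  moreover have "{a. \<exists>S\<in>#\<Sigma>. starts_at T s S a} = (\<Union>S\<in>set_mset \<Sigma>. {a. starts_at T s S a})"
    by blast
  ultimately show ?thesis by simp
qed

lemma well_formed_starts_at:
  assumes "holds T s (well_formed (A + C))" "S \<in># A" "S' \<in># C" "starts_at T s S a"
  shows "\<not> starts_at T s S' a"
proof -
  from assms(2,3) obtain A' C' where "A = add_mset S A'" "C = add_mset S' C'"
    by (metis insert_DiffM)
  then have "A + C = add_mset S (add_mset S' (A' + C'))" by simp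
  with assms(1) have "\<not> holds T s (collide S S')" unfolding holds_well_formed by blast
  with assms(4) show ?thesis by (auto simp: holds_collide starts_at_def)
qed

lemma well_formed_subset:
  assumes "holds T s (well_formed (A + C))"
  shows "holds T s (well_formed A)"
  using assms unfolding holds_well_formed by (metis union_mset_add_mset_left)

text \<open>Two colliding conjuncts would both own the cell at their common address.\<close>

lemma msat_imp_well_formed:
  assumes "\<forall>S\<in>#\<Sigma>. wf_spred T S" "msat T s h \<Sigma>"
  shows "holds T s (well_formed \<Sigma>)"
  unfolding holds_well_formed
proof (intro allI impI notI)
  fix S S' M
  assume \<Sigma>: "\<Sigma> = add_mset S (add_mset S' M)" and col: "holds T s (collide S S')"
  with assms(2) obtain g g' k where *: "dom g \<inter> dom (g' ++ k) = {}"
      "sat_spred T s g S" "sat_spred T s g' S'"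
    by (auto simp: msat_add_mset)
  from assms(1) \<Sigma> col obtain a where "starts_at T s S a" "starts_at T s S' a"
    by (auto simp: holds_collide starts_at_def elim!: nonempty_starts_at)
  with * sat_spred_starts_at have "a \<in> dom g" "a \<in> dom g'" by blast+
  with * show False by auto
qed

text \<open>Every nonempty conjunct receives its smallest model, and \<open>well_formed\<close>
  makes these cells distinct. Knowing the domain exactly matters as much as satisfaction: every
  address that starts no conjunct stays free.\<close>

lemma cell_model:
  assumes "\<forall>S\<in>#A. wf_spred T S" "holds T s (well_formed A)"
  obtains h where "msat T s h A" "\<And>a. a \<in> dom h \<longleftrightarrow> (\<exists>S\<in>#A. starts_at T s S a)"
    "\<And>S a. S \<in># A \<Longrightarrow> starts_at T s S a \<Longrightarrow> h a = Some (target S)"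
proof -
  from assms have "\<exists>h. msat T s h A \<and> (\<forall>a. a \<in> dom h \<longleftrightarrow> (\<exists>S\<in>#A. starts_at T s S a)) \<and>
      (\<forall>S\<in>#A. \<forall>a. starts_at T s S a \<longrightarrow> h a = Some (target S))"
  proof (induction A)
    case empty
    show ?case by (intro exI[of _ Map.empty]) (simp add: msat_empty)
  next
    case (add S A)
    from add.prems(2) have wf: "holds T s (well_formed ({#S#} + A))" by simp
    then have "holds T s (well_formed A)"
      using well_formed_subset[of A "{#S#}"] by (simp add: add.commute)
    with add obtain h where h: "msat T s h A" "\<forall>a. a \<in> dom h \<longleftrightarrow> (\<exists>S\<in>#A. starts_at T s S a)"
      "\<forall>S\<in>#A. \<forall>a. starts_at T s S a \<longrightarrow> h a = Some (target S)" by auto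
    have disj: "\<not> starts_at T s S' a" if "starts_at T s S a" "S' \<in># A" for S' a
      using well_formed_starts_at[OF wf _ that(2,1)] by simp
    show ?case
    proof (cases "nonempty T s S")
      case False
      then have "msat T s h (add_mset S A)" "\<not> starts_at T s S a" for a
        using h(1) add.prems(1) by (auto simp: msat_add_mset sat_spred_empty_iff starts_at_def)
      with h show ?thesis by (intro exI[of _ h]) auto
    next
      case True
      with add.prems(1) obtain a where a: "starts_at T s S a"
        by (auto elim: nonempty_starts_at)
      then have a_iff: "starts_at T s S c \<longleftrightarrow> c = a" for c
        by (auto simp: starts_at_def)
      have "a \<notin> dom h" using disj[OF a] h(2) by blast
      then have "msat T s ([a \<mapsto> target S] ++ h) (add_mset S A)"
        unfolding msat_add_mset using a h(1) add.prems(1)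
        by (intro exI[of _ "[a \<mapsto> target S]"] exI[of _ h]) (auto intro: sat_spred_cell)
      moreover have "c \<in> dom ([a \<mapsto> target S] ++ h) \<longleftrightarrow> (\<exists>S\<in>#add_mset S A. starts_at T s S c)" for c
        using h(2) a_iff by auto
      moreover have "([a \<mapsto> target S] ++ h) c = Some (target S')"
        if "S' \<in># add_mset S A" "starts_at T s S' c" for S' c
      proof (cases "S' \<in># A")
        case True
        with h(3) that show ?thesis by auto
      next
        case False
        with that a_iff have "S' = S" "c = a" by auto
        with \<open>a \<notin> dom h\<close> show ?thesis by (auto simp: map_add_def domIff)
      qed
      ultimately show ?thesis by blast
    qed
  qed
  then show thesis using that by blast
qed

text \<open>The countermodel is the model of \<open>cell_model\<close>, unless that one satisfies \<open>B\<close>. In the latter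
  case the cell of some \<open>lseg(x, y)\<close> in it is replaced by two cells that lead from \<open>x\<close> to \<open>y\<close> through
  an unallocated address \<open>f\<close>. If the conjunct \<open>S'\<close> of \<open>B\<close> at \<open>x\<close> is \<open>lseg(x', z)\<close>, choose \<open>f = z\<close>: then
  some conjunct other than \<open>S'\<close> would have to cover \<open>z\<close>, but its heap, being determined by its end
  points, is the one it has in the model of \<open>cell_model\<close>, where \<open>z\<close> is not allocated.\<close>

lemma stuck_countermodel:
  assumes wf: "\<forall>S\<in>#A + C. wf_spred T S" "\<forall>S\<in>#B. wf_spred T S"
    and wellf: "holds T s (well_formed (A + C))"
    and ne: "\<forall>S\<in>#A. nonempty T s S" "\<forall>S\<in>#B. nonempty T s S"
    and stuck: "\<forall>S\<in>#A. \<forall>S'\<in>#B. \<not> holds T s (guard (A + C) S S')"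
    and not_done: "\<not> (A = {#} \<and> B = {#})"
  shows "\<exists>h. msat T s h A \<and> \<not> msat T s h B \<and> (\<forall>S\<in>#C. \<forall>a. starts_at T s S a \<longrightarrow> a \<notin> dom h)"
proof -
  have wfA: "\<forall>S\<in>#A. wf_spred T S" using wf by auto
  obtain h0 where h0: "msat T s h0 A" "\<And>a. a \<in> dom h0 \<longleftrightarrow> (\<exists>S\<in>#A. starts_at T s S a)"
    "\<And>S a. S \<in># A \<Longrightarrow> starts_at T s S a \<Longrightarrow> h0 a = Some (target S)"
    using cell_model[OF wfA well_formed_subset[OF wellf]] by blast
  have avoid: "\<forall>S\<in>#C. \<forall>a. starts_at T s S a \<longrightarrow> a \<notin> dom h0"
    using h0(2) well_formed_starts_at[OF wellf] by blast
  show ?thesis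
  proof (cases "msat T s h0 B")
    case False
    with h0(1) avoid show ?thesis by blast
  next
    case h0_B: True
    \<comment> \<open>With \<open>B\<close> empty, \<open>h0\<close> would be empty, although each
      conjunct of \<open>A\<close> is nonempty and owns a cell.\<close>
    have "B \<noteq> {#}"
    proof
      assume "B = {#}"
      with h0_B have "h0 = Map.empty" by (simp add: msat_empty)
      with h0(2) have "\<not> starts_at T s S a" if "S \<in># A" for S a using that by auto
      with ne(1) wfA have "A = {#}" by (meson multiset_nonemptyE nonempty_starts_at)
      with \<open>B = {#}\<close> not_done show False by simp
    qed
    then obtain S' B' where B: "B = add_mset S' B'" by (metis multiset_cases)
    with wf(2) ne(2) obtain a where a': "starts_at T s S' a"
      by (auto elim: nonempty_starts_at)
    from h0_B B obtain g where g: "sat_spred T s g S'" "g \<subseteq>\<^sub>m h0"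
      by (auto elim: msat_member_obtain)
    have "a \<in> dom g" using a' g(1) by (rule sat_spred_starts_at)
    with g(2) have "g a = h0 a" "a \<in> dom h0"
      by (metis map_le_def domIff)+
    with h0(2,3) obtain S where S: "S \<in># A" "starts_at T s S a" and ga: "g a = Some (target S)"
      by metis
    have "\<not> holds T s (check (A + C) S S')"
      using S a' B stuck by (auto simp: holds_guard holds_collide starts_at_def)
    \<comment> \<open>Together with the failing \<open>check\<close> this excludes that
      \<open>S\<close> is a \<open>Next\<close>: \<open>check\<close> is \<open>Top\<close> against
      \<open>Lseg\<close>, and against \<open>Next\<close> it is exactly this equation.\<close>
    moreover have "target S = eval T s z" if "S' = Next x z" for x z
      using that g(1) ga a' by (auto simp: starts_at_simps)
    ultimately obtain x y where S_Lseg: "S = Lseg x y"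
      using S(2) a' by (cases S; cases S') (auto simp: starts_at_simps holds_simps)
    from S(1) wfA have "wf_spred T S" by blast
    with S_Lseg obtain b where "eval T s y = VInt b" by (auto elim: eval_IntS)
    with S(2) S_Lseg have b: "eval T s y = VInt b" "a \<noteq> b"
      by (auto simp: starts_at_simps)
    obtain f where f: "f \<noteq> a" "f \<noteq> b" "\<And>S. S \<in># A + C \<Longrightarrow> \<not> starts_at T s S f"
      and f': "\<And>x' z. S' = Next x' z \<Longrightarrow> eval T s z \<noteq> VInt f"
        "\<And>x' z. S' = Lseg x' z \<Longrightarrow> eval T s z = VInt f"
    proof -
      from a' have "S' \<noteq> Emp" by (auto simp: starts_at_simps)
      then consider x' z where "S' = Next x' z" | x' z where "S' = Lseg x' z"
        by (cases S') auto
      then show thesis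
      proof cases
        \<comment> \<open>Any \<open>f\<close> outside a finite set will do; it must differ from the
          value of \<open>z\<close> so that the new cell at \<open>a\<close> contradicts
          \<open>S'\<close>.\<close>
        case (1 x' z)
        with wf(2) B obtain c where c: "eval T s z = VInt c" by (auto elim: eval_IntS)
        have "finite ({a, b, c} \<union> {a. \<exists>S\<in>#A + C. starts_at T s S a})"
          by (intro finite_UnI finite_starts_at) simp
        from ex_new_if_finite[OF infinite_UNIV_int this] obtain f where
          "f \<notin> {a, b, c} \<union> {a. \<exists>S\<in>#A + C. starts_at T s S a}" ..
        with 1 c show thesis by (intro that[of f]) auto
      next
        \<comment> \<open>The failure of \<open>check\<close> for two segments says that
          \<open>z\<close> differs from \<open>y\<close> and is not allocated, so the value of
          \<open>z\<close> itself qualifies as \<open>f\<close>.\<close>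
        case (2 x' z)
        with wf(2) B obtain c where c: "eval T s z = VInt c" by (auto elim: eval_IntS)
        have "c \<noteq> b" "\<not> holds T s (alloc (A + C) z)"
          using \<open>\<not> holds T s (check (A + C) S S')\<close> 2 S_Lseg b c by (auto simp: holds_simps)
        moreover have "c \<noteq> a" using a' 2 c by (auto simp: starts_at_simps)
        ultimately show thesis using 2 c
          by (intro that[of c]) (auto simp: holds_alloc starts_at_def)
      qed
    qed
    from S(1) obtain A' where A: "A = add_mset S A'" by (metis insert_DiffM)
    \<comment> \<open>Here \<open>{#S#}\<close> takes the role of \<open>C\<close>, so that no
      conjunct of \<open>A'\<close> starts at \<open>a\<close>.\<close>
    have wfA': "\<forall>S\<in>#A'. wf_spred T S" and wellf': "holds T s (well_formed (A' + {#S#}))"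
      using wfA A well_formed_subset[OF wellf] by auto
    obtain h' where h': "msat T s h' A'" "\<And>a. a \<in> dom h' \<longleftrightarrow> (\<exists>S\<in>#A'. starts_at T s S a)"
      "\<And>S a. S \<in># A' \<Longrightarrow> starts_at T s S a \<Longrightarrow> h' a = Some (target S)"
      using cell_model[OF wfA' well_formed_subset[OF wellf']] by blast
    have "a \<notin> dom h'" "f \<notin> dom h'"
      using h'(2) well_formed_starts_at[OF wellf' _ _ ] S(2) f(3) A by auto
    define p :: "'u heap" where "p = [f \<mapsto> VInt b, a \<mapsto> VInt f]"
    define h1 where "h1 = p ++ h'"
    have p_dom: "dom p = {a, f}" "dom p \<inter> dom h' = {}"
      using \<open>a \<notin> dom h'\<close> \<open>f \<notin> dom h'\<close> by (auto simp: p_def)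
    have h1_a: "h1 a = Some (VInt f)"
      using \<open>a \<notin> dom h'\<close> by (simp add: h1_def p_def map_add_def domIff)
    have "seg a p b"
      unfolding p_def using f(1,2) b(2) by (intro seg_cons seg_cell) auto
    then have "sat_spred T s p S"
      using S(2) S_Lseg b by (simp add: sat_Lseg_iff starts_at_simps del: sat_spred.simps(3))
    with h'(1) p_dom(2) have "msat T s h1 A"
      unfolding A msat_add_mset h1_def by blast
    moreover have "\<not> msat T s h1 B"
    proof
      assume "msat T s h1 B"
      then obtain g1 k where k: "dom g1 \<inter> dom k = {}" "h1 = g1 ++ k" "sat_spred T s g1 S'"
          "msat T s k B'"
        by (auto simp: B msat_add_mset)
      have "a \<in> dom g1" using a' k(3) by (rule sat_spred_starts_at)
      show False
      proof (cases S')
        case Emp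
        with a' show False by (simp add: starts_at_simps)
      next
        case (Next x' z)
        with k(3) a' have "g1 a = Some (eval T s z)" by (auto simp: starts_at_simps)
        moreover have "g1 a = h1 a"
          using map_le_map_add_left[OF k(1)] \<open>a \<in> dom g1\<close> k(2) by (auto simp: map_le_def)
        ultimately show False using h1_a f'(1)[OF Next] by simp
      next
        case (Lseg x' z)
        with k(3) f'(2)[OF Lseg] obtain c where "seg c g1 f"
          by (auto simp: sat_Lseg_iff simp del: sat_spred.simps(3))
        then have "f \<notin> dom g1" by (rule seg_end_notin_dom)
        moreover have "f \<in> dom h1" using p_dom by (simp add: h1_def)
        ultimately have "f \<in> dom k" using k(2) by auto
        with k(4) obtain S2 g2 where g2: "S2 \<in># B'" "sat_spred T s g2 S2" "g2 \<subseteq>\<^sub>m k" "f \<in> dom g2"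
          by (rule msat_dom_obtain)
        obtain g3 where g3: "sat_spred T s g3 S2" "g3 \<subseteq>\<^sub>m h0"
          using h0_B g2(1) B by (auto elim: msat_member_obtain)
        have "f \<notin> dom h0" using h0(2) f(3) by auto
        \<comment> \<open>The cells of \<open>g2\<close> come from \<open>h1\<close> and those of
          \<open>g3\<close> from \<open>h0\<close>. These heaps can disagree on a common address
          only at \<open>a\<close> or \<open>f\<close>, but \<open>a\<close> belongs to
          \<open>g1\<close>, disjoint from \<open>g2\<close>, and \<open>f\<close> is not in
          \<open>h0\<close>.\<close>
        have "g2 = g3"
        proof (rule sat_spred_unique[OF g2(2) g3(1)], rule ballI)
          fix c assume c: "c \<in> dom g2 \<inter> dom g3"
          then have "c \<in> dom k" "c \<in> dom h0"
            using g2(3) g3(2) by (auto dest!: map_le_implies_dom_le)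
          with k(1) \<open>a \<in> dom g1\<close> \<open>f \<notin> dom h0\<close> have "c \<noteq> a" "c \<noteq> f" by auto
          from \<open>c \<in> dom h0\<close> obtain S0 where S0: "S0 \<in># A" "starts_at T s S0 c"
            using h0(2) by auto
          with S(2) \<open>c \<noteq> a\<close> A have "S0 \<in># A'" by (auto simp: starts_at_def)
          then have "h' c = h0 c" using S0 h0(3) h'(3) by simp
          moreover have "h1 c = h' c" using p_dom(1) \<open>c \<noteq> a\<close> \<open>c \<noteq> f\<close>
            by (auto simp: h1_def map_add_def split: option.split)
          moreover have "g2 c = h1 c"
            using c g2(3) k(2) \<open>c \<in> dom k\<close> by (auto simp: map_le_def)
          moreover have "g3 c = h0 c" using c g3(2) by (auto simp: map_le_def)
          ultimately show "g2 c = g3 c" by simp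
        qed
        with g2(4) g3(2) \<open>f \<notin> dom h0\<close> show False by (auto dest!: map_le_implies_dom_le)
      qed
    qed
    moreover have "c \<notin> dom h1" if "S0 \<in># C" "starts_at T s S0 c" for S0 c
    proof -
      have "c \<noteq> f" using f(3) that by auto
      moreover have "c \<noteq> a" using well_formed_starts_at[OF wellf S(1) that(1) S(2)] that(2) by auto
      moreover have "c \<notin> dom h'"
        using h'(2) A well_formed_starts_at[OF wellf _ that(1)] that(2) by auto
      ultimately show ?thesis using p_dom(1) by (auto simp: h1_def)
    qed
    ultimately show ?thesis by blast
  qed
qed

end

section \<open>Soundness and completeness of Match\<close>

lemma match_step_MReturn_rtranclp:
  "(match_step T s \<Sigma>)\<^sup>*\<^sup>* (MReturn U) m \<Longrightarrow> m = MReturn U"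
  by (erule converse_rtranclpE) (auto elim: match_step.cases)

text \<open>The guard rules out \<open>Emp\<close>, on which \<open>update\<close> is
  unspecified.\<close>

lemma wf_spred_update:
  "wf_spred T S \<Longrightarrow> wf_spred T S' \<Longrightarrow> holds T s (guard \<Sigma> S S') \<Longrightarrow> wf_spred T (update S S')"
  by (cases S; cases S') (auto simp: guard_def holds_simps)

context struct_stack
begin

text \<open>Here the run of Match is steered by another stack \<open>s'\<close>.\<close>

lemma match_sound:
  assumes "(match_step T s' \<Sigma>)\<^sup>*\<^sup>* (MCall Cs A B) (MReturn U)" "holds T s U"
    and "\<forall>S\<in>#\<Sigma>. wf_spred T S" "\<forall>S\<in>#B. wf_spred T S" "\<Sigma> = A + C"
  shows "(\<forall>P\<in>set Cs. holds T s P) \<and>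
    (\<forall>h k. msat T s h A \<longrightarrow> msat T s k C \<longrightarrow> dom h \<inter> dom k = {} \<longrightarrow> msat T s h B)"
  using assms
proof (induction "MCall Cs A B" arbitrary: Cs A B C rule: converse_rtranclp_induct)
  case (step m)
  from step.hyps(1) show ?case
  proof cases
    case (empty_left S)
    from \<open>S \<in># A\<close> obtain A' where A: "A = add_mset S A'" by (metis insert_DiffM)
    have "\<Sigma> = A' + add_mset S C" using step.prems A by simp
    with step.hyps(3)[OF _ step.prems(1-3)] empty_left A have
      Cs: "holds T s (empty_cond S)" "\<forall>P\<in>set Cs. holds T s P" and
      IH: "\<forall>h k. msat T s h A' \<longrightarrow> msat T s k (add_mset S C) \<longrightarrow> dom h \<inter> dom k = {} \<longrightarrow> msat T s h B"
      by auto
    have E: "sat_spred T s h S \<longleftrightarrow> h = Map.empty" for h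
      using sat_spred_empty_iff[of S] Cs(1) step.prems A by (auto simp: nonempty_def)
    then have "msat T s h A \<longleftrightarrow> msat T s h A'" "msat T s h (add_mset S C) \<longleftrightarrow> msat T s h C" for h
      using A by (auto simp: msat_add_mset)
    with IH Cs(2) show ?thesis by blast
  next
    case (empty_right S')
    from \<open>S' \<in># B\<close> obtain B' where B: "B = add_mset S' B'" by (metis insert_DiffM)
    with step.hyps(3)[OF _ step.prems(1,2)] empty_right step.prems have
      Cs: "holds T s (empty_cond S')" "\<forall>P\<in>set Cs. holds T s P" and
      IH: "\<forall>h k. msat T s h A \<longrightarrow> msat T s k C \<longrightarrow> dom h \<inter> dom k = {} \<longrightarrow> msat T s h B'"
      by auto
    have "sat_spred T s h S' \<longleftrightarrow> h = Map.empty" for h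
      using sat_spred_empty_iff[of S'] Cs(1) step.prems B by (auto simp: nonempty_def)
    then have "msat T s h B \<longleftrightarrow> msat T s h B'" for h
      using B by (auto simp: msat_add_mset)
    with IH Cs(2) show ?thesis by blast
  next
    case (guarded S S')
    from \<open>S \<in># A\<close> obtain A' where A: "A = add_mset S A'" by (metis insert_DiffM)
    from \<open>S' \<in># B\<close> obtain B' where B: "B = add_mset S' B'" by (metis insert_DiffM)
    have wf: "wf_spred T S" "wf_spred T S'" using step.prems A B by auto
    have "\<forall>S\<in>#add_mset (update S S') B'. wf_spred T S"
      using step.prems(3) B wf_spred_update[OF wf] guarded by auto
    moreover have "\<Sigma> = A' + add_mset S C" using step.prems A by simp
    ultimately have
      Cs: "holds T s (guard \<Sigma> S S')" "\<forall>P\<in>set Cs. holds T s P" and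
      IH: "\<forall>h k. msat T s h A' \<longrightarrow> msat T s k (add_mset S C) \<longrightarrow> dom h \<inter> dom k = {}
        \<longrightarrow> msat T s h (add_mset (update S S') B')"
      using step.hyps(3)[OF _ step.prems(1,2)] guarded A B by auto
    have "msat T s h B" if h: "msat T s h A" "msat T s k C" "dom h \<inter> dom k = {}" for h k
    proof -
      from h(1) A obtain g h' where g: "dom g \<inter> dom h' = {}" "h = g ++ h'"
          "sat_spred T s g S" "msat T s h' A'"
        by (auto simp: msat_add_mset)
      \<comment> \<open>As \<open>S\<close> joins the consumed conjuncts, its piece \<open>g\<close>
        joins their heap \<open>k\<close>.\<close>
      have "dom g \<inter> dom k = {}" "dom h' \<inter> dom (g ++ k) = {}"
        using g(1,2) h(3) by auto
      moreover from this have "msat T s (g ++ k) (add_mset S C)"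
        unfolding msat_add_mset using g(3) h(2) by blast
      ultimately      have "msat T s h' (add_mset (update S S') B')"
        using IH g(4) by blast
      then obtain q r where q: "dom q \<inter> dom r = {}" "h' = q ++ r"
          "sat_spred T s q (update S S')" "msat T s r B'"
        by (auto simp: msat_add_mset)
      have "dom g \<inter> dom q = {}" using g(1) q(2) by auto
      have "sat_spred T s (g ++ q) S'"
      proof (rule sat_spred_update_glue[OF wf Cs(1) g(3) q(3) \<open>dom g \<inter> dom q = {}\<close>])
        fix S0 a assume S0: "S0 \<in># \<Sigma>" "starts_at T s S0 a" "a \<in> dom g"
        \<comment> \<open>Any other occurrence would own its start address in \<open>h'\<close> or
          in \<open>k\<close>, both disjoint from \<open>g\<close>.\<close>
        have "S0 \<notin># A' + C"
        proof
          assume "S0 \<in># A' + C"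
          then consider "S0 \<in># A'" | "S0 \<in># C" by auto
          then obtain g0 where "sat_spred T s g0 S0" "g0 \<subseteq>\<^sub>m h' \<or> g0 \<subseteq>\<^sub>m k"
            by cases (meson msat_member_obtain g(4) h(2))+
          with S0(2) have "a \<in> dom h' \<or> a \<in> dom k"
            using sat_spred_starts_at by (metis map_le_implies_dom_le subsetD)
          with S0(3) g(1,2) h(3) show False by auto
        qed
        with S0(1) step.prems A show "S0 = S" by auto
      qed
      moreover have "h = (g ++ q) ++ r" "dom (g ++ q) \<inter> dom r = {}"
        using g(1,2) q(1,2) by auto
      ultimately show ?thesis unfolding B msat_add_mset using q(4) by blast
    qed
    with Cs(2) show ?thesis by blast
  next
    case return
    then have "U = fold Conj Cs (if A = {#} \<and> B = {#} then Top else Bot)"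
      using match_step_MReturn_rtranclp step.hyps(2) by blast
    with step.prems(1) have "\<forall>P\<in>set Cs. holds T s P" "A = {#}" "B = {#}"
      by (auto simp: holds_fold_Conj holds_simps split: if_splits)
    then show ?thesis by simp
  qed
qed

text \<open>The run is steered by \<open>s\<close> itself, so all collected conjuncts hold at
  \<open>s\<close>, and a false result means that the last call was stuck. The countermodel of that
  call is carried back to the first one; in the call after a step that consumes \<open>S\<close>,
  the clause about \<open>C\<close> covers \<open>S\<close> as well, so its start address is
  free.\<close>

lemma match_complete:
  assumes "(match_step T s \<Sigma>)\<^sup>*\<^sup>* (MCall Cs A B) (MReturn U)" "\<not> holds T s U"
    and "\<forall>P\<in>set Cs. holds T s P"
    and "\<forall>S\<in>#\<Sigma>. wf_spred T S" "\<forall>S\<in>#B. wf_spred T S" "\<Sigma> = A + C"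
    and "holds T s (well_formed \<Sigma>)"
  shows "\<exists>h. msat T s h A \<and> \<not> msat T s h B \<and> (\<forall>S\<in>#C. \<forall>a. starts_at T s S a \<longrightarrow> a \<notin> dom h)"
  using assms
proof (induction "MCall Cs A B" arbitrary: Cs A B C rule: converse_rtranclp_induct)
  case (step m)
  from step.hyps(1) show ?case
  proof cases
    case (empty_left S)
    from \<open>S \<in># A\<close> obtain A' where A: "A = add_mset S A'" by (metis insert_DiffM)
    have "\<Sigma> = A' + add_mset S C" using step.prems A by simp
    then obtain h where h: "msat T s h A'" "\<not> msat T s h B"
        "\<forall>S\<in>#add_mset S C. \<forall>a. starts_at T s S a \<longrightarrow> a \<notin> dom h"
      using step.hyps(3)[of _ A' B "add_mset S C"] empty_left A step.prems by auto
    have "sat_spred T s Map.empty S"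
      using sat_spred_empty_iff[of S] empty_left step.prems A by (auto simp: nonempty_def)
    with h(1) have "msat T s h A" unfolding A msat_add_mset by force
    with h show ?thesis by auto
  next
    case (empty_right S')
    from \<open>S' \<in># B\<close> obtain B' where B: "B = add_mset S' B'" by (metis insert_DiffM)
    then obtain h where h: "msat T s h A" "\<not> msat T s h B'"
        "\<forall>S\<in>#C. \<forall>a. starts_at T s S a \<longrightarrow> a \<notin> dom h"
      using step.hyps(3)[of _ A B' C] empty_right step.prems by auto
    have "sat_spred T s g S' \<longleftrightarrow> g = Map.empty" for g
      using sat_spred_empty_iff[of S'] empty_right step.prems B by (auto simp: nonempty_def)
    with h(2) have "\<not> msat T s h B" unfolding B msat_add_mset by auto
    with h show ?thesis by auto
  next
    case (guarded S S')
    from \<open>S \<in># A\<close> obtain A' where A: "A = add_mset S A'" by (metis insert_DiffM)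
    from \<open>S' \<in># B\<close> obtain B' where B: "B = add_mset S' B'" by (metis insert_DiffM)
    have wf: "wf_spred T S" "wf_spred T S'" using step.prems A B by auto
    have "\<forall>S\<in>#add_mset (update S S') B'. wf_spred T S"
      using step.prems(4) B wf_spred_update[OF wf] guarded by auto
    moreover have "\<Sigma> = A' + add_mset S C" using step.prems A by simp
    ultimately obtain h where h: "msat T s h A'" "\<not> msat T s h (add_mset (update S S') B')"
        "\<forall>S\<in>#add_mset S C. \<forall>a. starts_at T s S a \<longrightarrow> a \<notin> dom h"
      using step.hyps(3)[of _ A' "add_mset (update S S') B'" "add_mset S C"] guarded A B step.prems
      by auto
    obtain a where a: "starts_at T s S a" "starts_at T s S' a"
      using guard_starts_at wf(1) guarded by blast
    have "a \<notin> dom h" using h(3) a(1) by auto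
    define h1 where "h1 = [a \<mapsto> target S] ++ h"
    have "msat T s h1 A"
      unfolding A msat_add_mset h1_def using a(1) wf(1) \<open>a \<notin> dom h\<close> h(1)
      by (intro exI[of _ "[a \<mapsto> target S]"] exI[of _ h]) (auto intro: sat_spred_cell)
    \<comment> \<open>From a model of \<open>B\<close>, the cell at \<open>a\<close> could be cut
      off the piece of \<open>S'\<close>, leaving a model of the updated conjunction in
      \<open>h\<close>.\<close>
    moreover have "\<not> msat T s h1 B"
    proof
      assume "msat T s h1 B"
      then obtain g k where g: "dom g \<inter> dom k = {}" "h1 = g ++ k" "sat_spred T s g S'"
          "msat T s k B'"
        by (auto simp: B msat_add_mset)
      have "a \<in> dom g" using a(2) g(3) by (rule sat_spred_starts_at)
      then have "a \<notin> dom k" using g(1) by auto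
      have "h1 a = Some (target S)" "h1(a := None) = h"
        using \<open>a \<notin> dom h\<close> by (auto simp: h1_def map_add_def domIff fun_eq_iff split: option.split)
      moreover have "(g ++ k) a = g a" "(g ++ k)(a := None) = g(a := None) ++ k"
        using \<open>a \<notin> dom k\<close> by (auto simp: map_add_def domIff split: option.splits)
      ultimately have "g a = Some (target S)" "h = g(a := None) ++ k"
        using g(2) by simp_all
      moreover have "sat_spred T s (g(a := None)) (update S S')"
        using wf guarded a(1) g(3) calculation(1) by (intro sat_spred_update_cut)
      moreover have "dom (g(a := None)) \<inter> dom k = {}" using g(1) by auto
      ultimately have "msat T s h (add_mset (update S S') B')"
        unfolding msat_add_mset using g(4) by blast
      with h(2) show False ..
    qed
    moreover have "c \<notin> dom h1" if "S0 \<in># C" "starts_at T s S0 c" for S0 c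
    proof -
      have "c \<noteq> a"
        using well_formed_starts_at[of A C S S0 a] step.prems A a(1) that by auto
      then show ?thesis using h(3) that by (auto simp: h1_def)
    qed
    ultimately show ?thesis by blast
  next
    case return
    then have "U = fold Conj Cs (if A = {#} \<and> B = {#} then Top else Bot)"
      using match_step_MReturn_rtranclp step.hyps(2) by blast
    with step.prems(1,2) have "\<not> (A = {#} \<and> B = {#})"
      by (auto simp: holds_fold_Conj holds_simps)
    then show ?thesis
      using return step.prems by (intro stuck_countermodel) (auto simp: nonempty_def)
  qed
qed

end

section \<open>Termination and correctness of the procedure\<close>

fun match_size :: "('f, 's, 'x) match_state \<Rightarrow> nat" where
  "match_size (MCall Cs A B) = Suc (size A + size B)"
| "match_size (MReturn U) = 0"

text \<open>A guarded step adds one conjunct but removes two. The \<open>Suc\<close> in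
  \<open>match_size\<close> lets the final return decrease it too.\<close>

lemma match_step_size: "match_step T s \<Sigma> m m' \<Longrightarrow> match_size m' < match_size m"
  by (erule match_step.cases) (auto dest!: multi_member_split)

definition match_results ::
  "('f, 's, 'u) struct \<Rightarrow> ('f, 's, 'x) sconj \<Rightarrow> ('f, 's, 'x) match_state \<Rightarrow> ('f, 's, 'x) expr set"
where
  "match_results T \<Sigma> m =
    {U. \<exists>s :: ('s, 'x, 'u) stack. (match_step T s \<Sigma>)\<^sup>*\<^sup>* m (MReturn U)}"

text \<open>The stack merely selects among successors: without the side conditions on it, the
  candidates form a finite set \<open>N\<close>, and \<open>match_size\<close> bounds the depth.
  Ranging over all stacks makes the set the same for every pass of the loop.\<close>

lemma finite_match_results:
  fixes T :: "('f, 's, 'u) struct" and \<Sigma> :: "('f, 's, 'x) sconj"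
  shows "finite (match_results T \<Sigma> m)"
proof (induction m rule: measure_induct_rule[of match_size])
  case (less m)
  show ?case
  proof (cases m)
    case (MReturn U)
    have "match_results T \<Sigma> m \<subseteq> {U}"
      unfolding MReturn match_results_def by (auto dest: match_step_MReturn_rtranclp)
    then show ?thesis by (rule finite_subset) simp
  next
    case (MCall Cs A B)
    define N where "N = (\<lambda>S. MCall (empty_cond S # Cs) (A - {#S#}) B) ` set_mset A
      \<union> (\<lambda>S'. MCall (empty_cond S' # Cs) A (B - {#S'#})) ` set_mset B
      \<union> (\<lambda>(S, S'). MCall (guard \<Sigma> S S' # Cs) (A - {#S#}) ((B - {#S'#}) + {#update S S'#}))
          ` (set_mset A \<times> set_mset B)
      \<union> {MReturn (fold Conj Cs Top), MReturn (fold Conj Cs Bot)}"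
    have N: "m' \<in> N" if "match_step T s \<Sigma> m m'" for s :: "('s, 'x, 'u) stack" and m'
      using that unfolding MCall by cases (auto simp: N_def)
    have "match_results T \<Sigma> m
        \<subseteq> (\<Union>m' \<in> {m' \<in> N. match_size m' < match_size m}. match_results T \<Sigma> m')"
    proof
      fix U assume "U \<in> match_results T \<Sigma> m"
      then obtain s :: "('s, 'x, 'u) stack" where "(match_step T s \<Sigma>)\<^sup>*\<^sup>* m (MReturn U)"
        by (auto simp: match_results_def)
      then obtain m' where "match_step T s \<Sigma> m m'" "(match_step T s \<Sigma>)\<^sup>*\<^sup>* m' (MReturn U)"
        using MCall by (auto elim: converse_rtranclpE)
      then have "m' \<in> N" "match_size m' < match_size m" "U \<in> match_results T \<Sigma> m'"
        using N match_step_size by (auto simp only: match_results_def mem_Collect_eq)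
      then show "U \<in> (\<Union>m' \<in> {m' \<in> N. match_size m' < match_size m}. match_results T \<Sigma> m')"
        by blast
    qed
    moreover have "finite N" by (simp add: N_def)
    ultimately show ?thesis using less by (auto intro: finite_subset)
  qed
qed

lemma match_step_MCall_progress: "\<exists>m'. match_step T s \<Sigma> (MCall Cs A B) m'"
proof -
  consider S where "S \<in># A" "holds T s (empty_cond S)"
    | S' where "\<forall>S\<in>#A. \<not> holds T s (empty_cond S)" "S' \<in># B" "holds T s (empty_cond S')"
    | S S' where "\<forall>S\<in>#A. \<not> holds T s (empty_cond S)" "\<forall>S'\<in>#B. \<not> holds T s (empty_cond S')"
        "S \<in># A" "S' \<in># B" "holds T s (guard \<Sigma> S S')"
    | "\<forall>S\<in>#A. \<not> holds T s (empty_cond S)" "\<forall>S'\<in>#B. \<not> holds T s (empty_cond S')"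
        "\<forall>S\<in>#A. \<forall>S'\<in>#B. \<not> holds T s (guard \<Sigma> S S')"
    by blast
  then show ?thesis
  proof cases
    case 1
    then show ?thesis by (blast intro: match_step.empty_left)
  next
    case 2
    then show ?thesis by (blast intro: match_step.empty_right)
  next
    case 3
    then show ?thesis by (blast intro: match_step.guarded)
  next
    case 4
    then show ?thesis by (blast intro: match_step.return)
  qed
qed

lemma prove_step_progress: "(\<exists>c'. prove_step T \<Sigma> \<Pi>' \<Sigma>' c c') \<or> (\<exists>r. c = Done r)"
proof (cases c)
  case (Loop \<Gamma>)
  have "\<exists>a. oracle_answer T \<Gamma> a"
    by (metis oracle_answer.simps)
  then show ?thesis
    unfolding Loop by (metis not_Some_eq prove_step.loop_enter prove_step.loop_exit)
next
  case (Matching \<Gamma> s m)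
  then show ?thesis
    by (metis match_state.exhaust match_step_MCall_progress prove_step.continue
        prove_step.matching prove_step.refuted)
qed simp

section \<open>Invariant and rank of the loop\<close>

lemma sat_entailment:
  "sat T s h (entailment \<Pi> \<Sigma> \<Pi>' \<Sigma>') \<longleftrightarrow>
    (holds T s \<Pi> \<and> msat T s h \<Sigma> \<longrightarrow> holds T s \<Pi>' \<and> msat T s h \<Sigma>')"
  by (simp add: entailment_def sat_FSconj)

locale entailment_problem =
  fixes T :: "('f, 's, 'u) struct"
    and \<Pi> \<Pi>' :: "('f, 's, 'x) expr"
    and \<Sigma> \<Sigma>' :: "('f, 's, 'x) sconj"
  assumes wf_T: "wf_struct T"
    and wf_left: "\<forall>S\<in>#\<Sigma>. wf_spred T S" and wf_right: "\<forall>S\<in>#\<Sigma>'. wf_spred T S"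
begin

abbreviation run :: "('s, 'x, 'u) stack \<Rightarrow> ('f, 's, 'x) match_state \<Rightarrow> bool" where
  "run s m \<equiv> (match_step T s \<Sigma>)\<^sup>*\<^sup>* (MCall [] \<Sigma> \<Sigma>') m"

text \<open>\<Gamma> describes the stacks of the initial formula that are not yet settled; for those
  already removed, the conclusion of the entailment is secured on every model of
  \<open>\<Sigma>\<close>.\<close>

definition loop_inv :: "('f, 's, 'x) expr \<Rightarrow> bool" where
  "loop_inv \<Gamma> \<longleftrightarrow> (\<forall>s :: ('s, 'x, 'u) stack. is_stack T s \<longrightarrow>
    (if holds T s \<Gamma> then holds T s \<Pi> \<and> holds T s (well_formed \<Sigma>)
     else holds T s \<Pi> \<and> holds T s (well_formed \<Sigma>) \<longrightarrow>
       holds T s \<Pi>' \<and> (\<forall>h. msat T s h \<Sigma> \<longrightarrow> msat T s h \<Sigma>')))"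

fun state_inv :: "('f, 's, 'x, 'u) prove_state \<Rightarrow> bool" where
  "state_inv (Loop \<Gamma>) \<longleftrightarrow> loop_inv \<Gamma>"
| "state_inv (Matching \<Gamma> s m) \<longleftrightarrow> loop_inv \<Gamma> \<and> is_stack T s \<and> holds T s \<Gamma> \<and> run s m"
| "state_inv (Done Valid) \<longleftrightarrow> valid T (entailment \<Pi> \<Sigma> \<Pi>' \<Sigma>')"
| "state_inv (Done Invalid) \<longleftrightarrow> \<not> valid T (entailment \<Pi> \<Sigma> \<Pi>' \<Sigma>')"

lemma state_inv_init: "state_inv (prove_init \<Pi> \<Sigma>)"
  by (auto simp: prove_init_def loop_inv_def holds_simps)

text \<open>On exit every stack is settled, or violates \<Pi> or \<open>well_formed\<close>. A
  refutation comes from \<open>match_complete\<close> or from the failure of \<open>\<Pi>'\<close>,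
  and a further pass rests on \<open>match_sound\<close>; both lemmas are used with nothing
  consumed.\<close>

lemma prove_step_inv:
  assumes "prove_step T \<Sigma> \<Pi>' \<Sigma>' c c'" "state_inv c"
  shows "state_inv c'"
  using assms(1)
proof cases
  case (loop_exit \<Gamma>)
  have "sat T s h (entailment \<Pi> \<Sigma> \<Pi>' \<Sigma>')" if s: "is_stack T s" for s h
    unfolding sat_entailment
  proof (intro impI, elim conjE)
    interpret struct_stack T s using wf_T s by unfold_locales
    assume "holds T s \<Pi>" and h: "msat T s h \<Sigma>"
    then show "holds T s \<Pi>' \<and> msat T s h \<Sigma>'"
      using loop_exit assms(2) s msat_imp_well_formed[OF wf_left h] by (auto simp: loop_inv_def)
  qed
  with loop_exit show ?thesis by (simp add: valid_def)
next
  case (refuted s U \<Gamma>)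
  with assms(2) have s: "is_stack T s" "holds T s \<Pi>" "holds T s (well_formed \<Sigma>)"
      and U: "run s (MReturn U)"
    by (auto simp: loop_inv_def)
  interpret struct_stack T s using wf_T s(1) by unfold_locales
  have "\<exists>h. \<not> sat T s h (entailment \<Pi> \<Sigma> \<Pi>' \<Sigma>')"
  proof (cases "holds T s \<Pi>'")
    case True
    with refuted have "\<not> holds T s U" by (simp add: holds_simps)
    from match_complete[OF U this, of "{#}"] obtain h where "msat T s h \<Sigma>" "\<not> msat T s h \<Sigma>'"
      using wf_left wf_right s(3) by auto
    with s(2) show ?thesis by (auto simp: sat_entailment)
  next
    case False
    \<comment> \<open>A false \<open>\<Pi>'\<close> refutes the entailment only if
      \<open>\<Sigma>\<close> has a model at \<open>s\<close>; \<open>well_formed\<close> provides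
      one.\<close>
    obtain h where "msat T s h \<Sigma>"
      by (rule cell_model[OF wf_left s(3)]) (rule that)
    with False s(2) show ?thesis by (auto simp: sat_entailment)
  qed
  with s(1) refuted show ?thesis by (auto simp: valid_def)
next
  case (continue s U \<Gamma>)
  \<comment> \<open>The result computed for \<open>s\<close> is applied to every stack
    \<open>s'\<close> that satisfies it, since all of them leave \<Gamma>.\<close>
  have "holds T s' \<Pi>' \<and> (\<forall>h. msat T s' h \<Sigma> \<longrightarrow> msat T s' h \<Sigma>')"
    if "is_stack T s'" "holds T s' (Conj \<Pi>' U)" for s'
  proof -
    interpret struct_stack T s' using wf_T that(1) by unfold_locales
    have "run s (MReturn U)" using continue assms(2) by simp
    from match_sound[OF this _ wf_left wf_right, of "{#}"] that(2) show ?thesis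
      by (auto simp: holds_simps msat_empty)
  qed
  with continue assms(2) show ?thesis
    by (auto simp: loop_inv_def holds_simps)
qed (use assms(2) in auto)

lemma prove_steps_inv: "(prove_step T \<Sigma> \<Pi>' \<Sigma>')\<^sup>*\<^sup>* (prove_init \<Pi> \<Sigma>) c \<Longrightarrow> state_inv c"
  by (induction rule: rtranclp_induct) (auto intro: state_inv_init prove_step_inv)

text \<open>Match has finitely many possible results. A pass through the loop that continues
  makes \<open>\<Gamma>\<close> inconsistent with the result obtained, which was consistent with \<open>\<Gamma>\<close> before.\<close>

definition open_results :: "('f, 's, 'x) expr \<Rightarrow> ('f, 's, 'x) expr set" where
  "open_results \<Gamma> = {U \<in> match_results T \<Sigma> (MCall [] \<Sigma> \<Sigma>').
    \<exists>s :: ('s, 'x, 'u) stack. is_stack T s \<and> holds T s \<Gamma> \<and> holds T s (Conj \<Pi>' U)}"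

text \<open>The first call of Match has \<open>match_size\<close> one more than the two sizes
  together, so matching begins at 2 plus these sizes and \<open>Loop\<close> must lie above, hence
  the 3.\<close>

fun prove_rank :: "('f, 's, 'x, 'u) prove_state \<Rightarrow> nat \<times> nat" where
  "prove_rank (Loop \<Gamma>) = (card (open_results \<Gamma>), 3 + size \<Sigma> + size \<Sigma>')"
| "prove_rank (Matching \<Gamma> s m) = (card (open_results \<Gamma>), Suc (match_size m))"
| "prove_rank (Done r) = (0, 0)"

lemma prove_step_rank:
  assumes "prove_step T \<Sigma> \<Pi>' \<Sigma>' c c'" "state_inv c"
  shows "(prove_rank c', prove_rank c) \<in> less_than <*lex*> less_than"
  using assms(1)
proof cases
  case (matching s m m' \<Gamma>)
  then show ?thesis using match_step_size by auto
next
  case (continue s U \<Gamma>)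
  let ?\<Gamma>' = "Conj \<Gamma> (Neg (Conj \<Pi>' U))"
  from continue assms(2) have "U \<in> open_results \<Gamma>"
    by (auto simp: open_results_def match_results_def)
  moreover have "open_results ?\<Gamma>' \<subseteq> open_results \<Gamma>" "U \<notin> open_results ?\<Gamma>'"
    by (auto simp: open_results_def holds_simps)
  moreover have "finite (open_results \<Gamma>)"
    using finite_match_results by (auto simp: open_results_def intro: finite_subset)
  ultimately have "card (open_results ?\<Gamma>') < card (open_results \<Gamma>)"
    by (metis psubsetI psubset_card_mono)
  with continue show ?thesis by simp
qed auto

lemma inv_termip: "state_inv c \<Longrightarrow> termip (prove_step T \<Sigma> \<Pi>' \<Sigma>') c"
proof (induction c rule: wf_induct_rule[OF wf_inv_image[OF wf_lex_prod[OF wf_less_than wf_less_than]],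
    of prove_rank])
  case (1 c)
  show ?case
  proof (rule accp.accI)
    fix c' assume "(prove_step T \<Sigma> \<Pi>' \<Sigma>')\<inverse>\<inverse> c' c"
    then have step: "prove_step T \<Sigma> \<Pi>' \<Sigma>' c c'" by simp
    then show "termip (prove_step T \<Sigma> \<Pi>' \<Sigma>') c'"
      using prove_step_rank[OF step 1(2)] prove_step_inv[OF step 1(2)]
      by (intro 1(1)) (simp_all add: inv_image_def)
  qed
qed

lemma prove_terminates: "prove_terminates T \<Pi> \<Sigma> \<Pi>' \<Sigma>'"
  unfolding prove_terminates_def using inv_termip[OF state_inv_init] prove_step_progress by metis

text \<open>Following any successors from the start must end by termination, and by progress it can
  end only in a verdict.\<close>

lemma prove_returns_some: "\<exists>r. prove_returns T \<Pi> \<Sigma> \<Pi>' \<Sigma>' r"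
proof -
  have "\<exists>r. (prove_step T \<Sigma> \<Pi>' \<Sigma>')\<^sup>*\<^sup>* c (Done r)" if "state_inv c" for c
    using inv_termip[OF that]
  proof (induction rule: accp.induct)
    case (accI c)
    then show ?case
      using prove_step_progress[of T \<Sigma> \<Pi>' \<Sigma>' c]
      by (metis conversepI converse_rtranclp_into_rtranclp rtranclp.rtrancl_refl)
  qed
  with state_inv_init show ?thesis by (simp add: prove_returns_def)
qed

lemma prove_returns_inv: "prove_returns T \<Pi> \<Sigma> \<Pi>' \<Sigma>' r \<Longrightarrow> state_inv (Done r)"
  unfolding prove_returns_def by (rule prove_steps_inv)

end

theorem theorem3:
  fixes T :: "('f, 's, 'u) struct"
    and \<Pi> \<Pi>' :: "('f, 's, 'x) expr"
    and \<Sigma> \<Sigma>' :: "('f, 's, 'x) sconj"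
  assumes "wf_struct T"
    and "has_sort T \<Pi> BoolS" and "has_sort T \<Pi>' BoolS"
    and "\<forall>S\<in>#\<Sigma>. wf_spred T S" and "\<forall>S\<in>#\<Sigma>'. wf_spred T S"
  shows "prove_terminates T \<Pi> \<Sigma> \<Pi>' \<Sigma>' \<and>
    (prove_returns T \<Pi> \<Sigma> \<Pi>' \<Sigma>' Valid \<longleftrightarrow> valid T (entailment \<Pi> \<Sigma> \<Pi>' \<Sigma>')) \<and>
    (prove_returns T \<Pi> \<Sigma> \<Pi>' \<Sigma>' Invalid \<longleftrightarrow> \<not> valid T (entailment \<Pi> \<Sigma> \<Pi>' \<Sigma>'))"
proof -
  interpret entailment_problem T \<Pi> \<Pi>' \<Sigma> \<Sigma>'
    using assms by unfold_locales
  \<comment> \<open>Each returned verdict is correct by the invariant; that some verdict is returned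
    yields the converse directions.\<close>
  have "prove_returns T \<Pi> \<Sigma> \<Pi>' \<Sigma>' Valid \<or> prove_returns T \<Pi> \<Sigma> \<Pi>' \<Sigma>' Invalid"
    using prove_returns_some by (metis verdict.exhaust)
  then show ?thesis
    using prove_terminates prove_returns_inv[of Valid] prove_returns_inv[of Invalid] by auto
qed

end
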